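(* Let $n\ge2$, let $\Omega$ be a bounded Lipschitz domain in $\mathbb{R}^{n}$, let $k_{1}=\cdots=k_{m}=k$ with $0\le k<k_{*}$ and let $f_{i}\in L^{\infty}(\Omega)$ for all $i=1,\dots,m$. Then for each minimizer $\mathbf{u}_{*}=(u_{*,1},\dots,u_{*,m})$ of the functional $\mathcal{J}_{\mathbf{k}}$ in $\mathbb{S}_{m}(\Omega)$ one has $$\operatorname{supp}(u_{*,i})\subset\operatorname{supp}(v_{*,i})\quad\text{for all }i=1,\dots,m,$$ where $\mathbf{v}_{*}=(v_{*,1},\dots,v_{*,m})$ is the unique minimizer of the functional $\mathcal{J}_{\mathbf{k}}$ in $\mathbb{K}_{m}(\Omega)$.
   Context: $\mathbf{k}=(k_{1},\dots,k_{m})$. For $\mathbf{u}=(u_{1},\dots,u_{m})\in(H^{1}(\Omega))^{m}$, $$\mathcal{J}_{\mathbf{k}}(\mathbf{u}):=\sum_{i=1}^{m}\mathcal{J}_{k_{i}}(u_{i}),\qquad \mathcal{J}_{k_{i}}(u_{i}):=\int_{\Omega}\left(|\nabla u_{i}|^{2}-k_{i}^{2}|u_{i}|^{2}-2f_{i}u_{i}\right)dx.$$ Define $$\mathbb{K}_{m}(\Omega):=\{(u_{1},\dots,u_{m})\in(H_{0}^{1}(\Omega))^{m}:u_{i}\ge0\text{ for all }i\},$$ $$\mathbb{S}_{m}(\Omega):=\{(u_{1},\dots,u_{m})\in\mathbb{K}_{m}(\Omega):u_{i}\cdot u_{j}=0\text{ for all }i\ne j\}.$$ The number $k_{*}=k_{*}(\Omega)>0$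 is given by $$k_{*}^{2}:=\inf_{\phi\in C_{c}^{\infty}(\Omega),\,\phi\not\equiv0}\frac{\|\nabla\phi\|_{L^{2}(\Omega)}^{2}}{\|\phi\|_{L^{2}(\Omega)}^{2}}.$$ For $0\le k_i<k_*$, the functional $\mathcal{J}_{k_i}$ has a unique minimizer $v_{*,i}$ in $\mathbb{K}_{1}(\Omega)$, and $\mathbf{v}_{*}=(v_{*,1},\dots,v_{*,m})$ is the unique minimizer of $\mathcal{J}_{\mathbf{k}}$ in $\mathbb{K}_{m}(\Omega)$. *)

theory Defs
  imports "HOL-Analysis.Analysis"
begin

text \<open>
  Elements of \<open>L\<^sup>2(\<Omega>)\<close>, \<open>L\<^sup>\<infinity>(\<Omega>)\<close>, \<open>H\<^sup>1(\<Omega>)\<close> are represented by functions on the whole space. Only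
  their values on \<open>\<Omega>\<close>, up to Lebesgue null sets, matter; accordingly pointwise relations between
  such elements are required almost everywhere in \<open>\<Omega>\<close>.
\<close>

text \<open>Near every boundary point, and in suitable orthonormal coordinates whose last axis is \<open>e\<close>,
  the domain is the part of a ball above the graph of a Lipschitz function \<open>\<gamma>\<close> on \<open>e\<^sup>\<bottom>\<close>.\<close>

definition lipschitz_boundary :: "'a::euclidean_space set \<Rightarrow> bool" where
  "lipschitz_boundary \<Omega> \<longleftrightarrow>
    (\<forall>p\<in>frontier \<Omega>. \<exists>e \<gamma> C r. norm e = 1 \<and> C-lipschitz_on {y. y \<bullet> e = 0} \<gamma> \<and> r > 0 \<and>
       \<Omega> \<inter> ball p r = {x \<in> ball p r. \<gamma> (x - (x \<bullet> e) *\<^sub>R e) < x \<bullet> e})"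

definition bounded_lipschitz_domain :: "'a::euclidean_space set \<Rightarrow> bool" where
  "bounded_lipschitz_domain \<Omega> \<longleftrightarrow>
    open \<Omega> \<and> connected \<Omega> \<and> \<Omega> \<noteq> {} \<and> bounded \<Omega> \<and> lipschitz_boundary \<Omega>"

text \<open>The partial derivative in the coordinate direction \<open>b\<close> is \<open>frechet_derivative \<phi> (at x) b\<close>.\<close>

fun C_diff :: "nat \<Rightarrow> ('a::euclidean_space \<Rightarrow> real) \<Rightarrow> bool" where
  "C_diff 0 \<phi> \<longleftrightarrow> continuous_on UNIV \<phi>"
| "C_diff (Suc j) \<phi> \<longleftrightarrow> \<phi> differentiable_on UNIV \<and>
     (\<forall>b\<in>Basis. C_diff j (\<lambda>x. frechet_derivative \<phi> (at x) b))"

definition test_functions :: "'a::euclidean_space set \<Rightarrow> ('a \<Rightarrow> real) set" where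
  "test_functions \<Omega> = {\<phi>. (\<forall>j. C_diff j \<phi>) \<and>
     compact (closure {x. \<phi> x \<noteq> 0}) \<and> closure {x. \<phi> x \<noteq> 0} \<subseteq> \<Omega>}"

definition grad :: "('a::euclidean_space \<Rightarrow> real) \<Rightarrow> 'a \<Rightarrow> 'a" where
  "grad \<phi> x = (\<Sum>b\<in>Basis. frechet_derivative \<phi> (at x) b *\<^sub>R b)"

definition L2 :: "'a::euclidean_space set \<Rightarrow> ('a \<Rightarrow> 'b::euclidean_space) set" where
  "L2 \<Omega> = {f \<in> borel_measurable (lebesgue_on \<Omega>). integrable (lebesgue_on \<Omega>) (\<lambda>x. (norm (f x))\<^sup>2)}"

definition L2_norm :: "'a::euclidean_space set \<Rightarrow> ('a \<Rightarrow> 'b::euclidean_space) \<Rightarrow> real" where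
  "L2_norm \<Omega> f = sqrt (\<integral>x. (norm (f x))\<^sup>2 \<partial>lebesgue_on \<Omega>)"

definition L_infinity :: "'a::euclidean_space set \<Rightarrow> ('a \<Rightarrow> real) set" where
  "L_infinity \<Omega> = {f \<in> borel_measurable (lebesgue_on \<Omega>). \<exists>C. AE x in lebesgue_on \<Omega>. \<bar>f x\<bar> \<le> C}"

definition locally_integrable :: "'a::euclidean_space set \<Rightarrow> ('a \<Rightarrow> 'b::euclidean_space) \<Rightarrow> bool" where
  "locally_integrable \<Omega> f \<longleftrightarrow> (\<forall>K. compact K \<and> K \<subseteq> \<Omega> \<longrightarrow> integrable (lebesgue_on K) f)"

definition has_weak_gradient ::
    "'a::euclidean_space set \<Rightarrow> ('a \<Rightarrow> real) \<Rightarrow> ('a \<Rightarrow> 'a) \<Rightarrow> bool" where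
  "has_weak_gradient \<Omega> u g \<longleftrightarrow> locally_integrable \<Omega> u \<and> locally_integrable \<Omega> g \<and>
    (\<forall>\<phi>\<in>test_functions \<Omega>. \<forall>b\<in>Basis.
       (\<integral>x. u x * frechet_derivative \<phi> (at x) b \<partial>lebesgue_on \<Omega>) =
       - (\<integral>x. (g x \<bullet> b) * \<phi> x \<partial>lebesgue_on \<Omega>))"

text \<open>A weak gradient is determined almost everywhere in the open set \<open>\<Omega>\<close>, so integrals involving
  \<open>weak_grad\<close> do not depend on the choice.\<close>

definition weak_grad :: "'a::euclidean_space set \<Rightarrow> ('a \<Rightarrow> real) \<Rightarrow> 'a \<Rightarrow> 'a" where
  "weak_grad \<Omega> u = (SOME g. has_weak_gradient \<Omega> u g)"

definition H1 :: "'a::euclidean_space set \<Rightarrow> ('a \<Rightarrow> real) set" where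
  "H1 \<Omega> = {u \<in> L2 \<Omega>. \<exists>g\<in>L2 \<Omega>. has_weak_gradient \<Omega> u g}"

definition H1_norm :: "'a::euclidean_space set \<Rightarrow> ('a \<Rightarrow> real) \<Rightarrow> real" where
  "H1_norm \<Omega> u = sqrt ((L2_norm \<Omega> u)\<^sup>2 + (L2_norm \<Omega> (weak_grad \<Omega> u))\<^sup>2)"

definition H10 :: "'a::euclidean_space set \<Rightarrow> ('a \<Rightarrow> real) set" where
  "H10 \<Omega> = {u \<in> H1 \<Omega>. \<exists>\<phi>. (\<forall>j::nat. \<phi> j \<in> test_functions \<Omega>) \<and>
     (\<lambda>j. H1_norm \<Omega> (\<lambda>x. u x - \<phi> j x)) \<longlonglongrightarrow> 0}"

definition k_star :: "'a::euclidean_space set \<Rightarrow> real" where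
  "k_star \<Omega> = sqrt (INF \<phi> \<in> {\<phi> \<in> test_functions \<Omega>. \<exists>x. \<phi> x \<noteq> 0}.
     (L2_norm \<Omega> (grad \<phi>))\<^sup>2 / (L2_norm \<Omega> \<phi>)\<^sup>2)"

definition J_scalar ::
    "'a::euclidean_space set \<Rightarrow> real \<Rightarrow> ('a \<Rightarrow> real) \<Rightarrow> ('a \<Rightarrow> real) \<Rightarrow> real" where
  "J_scalar \<Omega> k f u =
    (\<integral>x. (norm (weak_grad \<Omega> u x))\<^sup>2 - k\<^sup>2 * \<bar>u x\<bar>\<^sup>2 - 2 * f x * u x \<partial>lebesgue_on \<Omega>)"

text \<open>An \<open>m\<close>-tuple is a family indexed by \<open>nat\<close> of which only the entries \<open>1, \<dots>, m\<close> are used.\<close>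

definition J_functional :: "'a::euclidean_space set \<Rightarrow> nat \<Rightarrow> (nat \<Rightarrow> real) \<Rightarrow>
    (nat \<Rightarrow> 'a \<Rightarrow> real) \<Rightarrow> (nat \<Rightarrow> 'a \<Rightarrow> real) \<Rightarrow> real" where
  "J_functional \<Omega> m k f u = (\<Sum>i=1..m. J_scalar \<Omega> (k i) (f i) (u i))"

definition K_set :: "'a::euclidean_space set \<Rightarrow> nat \<Rightarrow> (nat \<Rightarrow> 'a \<Rightarrow> real) set" where
  "K_set \<Omega> m = {u. \<forall>i\<in>{1..m}. u i \<in> H10 \<Omega> \<and> (AE x in lebesgue_on \<Omega>. 0 \<le> u i x)}"

definition S_set :: "'a::euclidean_space set \<Rightarrow> nat \<Rightarrow> (nat \<Rightarrow> 'a \<Rightarrow> real) set" where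
  "S_set \<Omega> m = {u \<in> K_set \<Omega> m. \<forall>i\<in>{1..m}. \<forall>j\<in>{1..m}. i \<noteq> j \<longrightarrow>
     (AE x in lebesgue_on \<Omega>. u i x * u j x = 0)}"

text \<open>The support of an almost-everywhere class on \<open>\<Omega>\<close>: the complement in \<open>\<Omega>\<close> of the largest open
  subset of \<open>\<Omega>\<close> on which the function vanishes almost everywhere. It is closed relative to \<open>\<Omega>\<close>.\<close>

definition ess_supp :: "'a::euclidean_space set \<Rightarrow> ('a \<Rightarrow> real) \<Rightarrow> 'a set" where
  "ess_supp \<Omega> u = \<Omega> - \<Union>{U. open U \<and> U \<subseteq> \<Omega> \<and> (AE x in lebesgue_on U. u x = 0)}"

end

theory Submission
  imports Defs
begin

text \<open>
  With \<open>J\<close> the scalar functional for \<open>f\<^sub>i\<close>, both \<open>max u\<^sub>i v\<^sub>i\<close> and \<open>min u\<^sub>i v\<^sub>i\<close> are nonnegative elements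
  of \<open>H10\<close> and \<open>J (max u\<^sub>i v\<^sub>i) + J (min u\<^sub>i v\<^sub>i) \<le> J u\<^sub>i + J v\<^sub>i\<close>. Replacing \<open>u\<^sub>i\<close> by \<open>min u\<^sub>i v\<^sub>i\<close> does not
  leave the segregated class, so \<open>J u\<^sub>i \<le> J (min u\<^sub>i v\<^sub>i)\<close> and therefore \<open>J (max u\<^sub>i v\<^sub>i) \<le> J v\<^sub>i\<close>. As
  \<open>k < k_star\<close> makes \<open>J\<close> strictly convex, \<open>max u\<^sub>i v\<^sub>i = v\<^sub>i\<close> almost everywhere, that is \<open>u\<^sub>i \<le> v\<^sub>i\<close>.
  The inequality for \<open>max\<close> and \<open>min\<close> reduces, by the parallelogram law, to the fact that \<open>\<bar>w\<bar>\<close> lies in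
  \<open>H10\<close> with weak gradient \<open>sgn w * grad w\<close> whenever \<open>w\<close> does.
\<close>

subsection \<open>Smooth functions\<close>

text \<open>The obstacle lies in the encoding. \<open>weak_grad\<close> is a choice and
  \<open>H10\<close> is stated through \<open>H1_norm\<close> of differences, so an energy can be
  computed only once weak gradients are known to be unique almost everywhere and to agree with the
  classical gradient on test functions. Uniqueness needs test functions that detect every small box
  (\<open>box_cutoff\<close>); agreement needs integration by parts. The absolute value is not
  smooth, so \<open>\<bar>w\<bar>\<close> is reached by two nested limits: test functions approach
  \<open>w\<close> with the smoothing parameter fixed, and the parameter goes to 0 afterwards.
  Segregation survives the passage to the minimum because \<open>v i\<close> is nonnegative: the
  minimum vanishes wherever \<open>u i\<close> does. The maximum may overlap other components, hence
  it is compared only with \<open>v i\<close>, whose class carries no such constraint. The convexity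
  gap is a multiple of \<open>(k_star \<Omega>)\<^sup>2 - k\<^sup>2\<close>, because the infimum
  defining \<open>k_star\<close> bounds the gradient on all of \<open>H10\<close> by
  density.\<close>

lemma C_diff_SucI:
  fixes \<phi> :: "'a::euclidean_space \<Rightarrow> real"
  assumes D: "\<And>x. (\<phi> has_derivative D x) (at x)"
    and C: "\<And>b. b \<in> Basis \<Longrightarrow> C_diff j (\<lambda>x. D x b)"
  shows "C_diff (Suc j) \<phi>"
proof -
  \<comment> \<open>\<open>frechet_derivative\<close> is a choice; uniqueness of derivatives lets
    any explicitly known \<open>D\<close> stand in for it.\<close>
  have "frechet_derivative \<phi> (at x) = D x" for x
    using frechet_derivative_at[OF D] by simp
  moreover have "\<phi> differentiable_on UNIV"
    using D by (auto simp: differentiable_on_def differentiable_def intro: has_derivative_at_withinI)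
  ultimately show ?thesis using C by simp
qed

lemma C_diff_has_derivative:
  fixes \<phi> :: "'a::euclidean_space \<Rightarrow> real"
  assumes "C_diff (Suc j) \<phi>"
  shows "(\<phi> has_derivative frechet_derivative \<phi> (at x)) (at x)"
  using assms by (simp add: differentiable_on_def frechet_derivative_works)

lemma C_diff_SucD: "C_diff (Suc j) \<phi> \<Longrightarrow> C_diff j \<phi>"
proof (induction j arbitrary: \<phi>)
  case 0
  then show ?case by (simp add: differentiable_imp_continuous_on)
next
  case (Suc j)
  then show ?case by (metis C_diff.simps(2))
qed

lemma C_diff_const: "C_diff j (\<lambda>x. c)"
proof (induction j arbitrary: c)
  case (Suc j)
  then show ?case by (intro C_diff_SucI[where D = "\<lambda>x h. 0"]) auto
qed auto

lemma C_diff_inner: "C_diff j (\<lambda>x. x \<bullet> a)"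
proof (cases j)
  case (Suc i)
  have "((\<lambda>x. x \<bullet> a) has_derivative (\<lambda>h. h \<bullet> a)) (at x)" for x
    by (auto intro!: derivative_eq_intros)
  then show ?thesis
    unfolding Suc by (rule C_diff_SucI) (rule C_diff_const)
qed (auto intro!: continuous_intros)

lemma C_diff_add: "C_diff j \<phi> \<Longrightarrow> C_diff j \<psi> \<Longrightarrow> C_diff j (\<lambda>x. \<phi> x + \<psi> x)"
proof (induction j arbitrary: \<phi> \<psi>)
  case (Suc j)
  then show ?case
    by (intro C_diff_SucI[OF has_derivative_add[OF C_diff_has_derivative C_diff_has_derivative]]) auto
qed (auto intro: continuous_intros)

lemma C_diff_mult: "C_diff j \<phi> \<Longrightarrow> C_diff j \<psi> \<Longrightarrow> C_diff j (\<lambda>x. \<phi> x * \<psi> x)"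
proof (induction j arbitrary: \<phi> \<psi>)
  case (Suc j)
  then show ?case
    by (intro C_diff_SucI[OF has_derivative_mult[OF C_diff_has_derivative C_diff_has_derivative]]
        C_diff_add Suc.IH) (auto intro: C_diff_SucD)
qed (auto intro: continuous_intros)

lemma C_diff_diff: "C_diff j \<phi> \<Longrightarrow> C_diff j \<psi> \<Longrightarrow> C_diff j (\<lambda>x. \<phi> x - \<psi> x)"
  using C_diff_add[OF _ C_diff_mult[OF C_diff_const[of j "-1"]]] by simp

lemma C_diff_prod:
  "finite I \<Longrightarrow> (\<And>i. i \<in> I \<Longrightarrow> C_diff j (\<phi> i)) \<Longrightarrow> C_diff j (\<lambda>x. \<Prod>i\<in>I. \<phi> i x)"
  by (induction I rule: finite_induct) (auto intro: C_diff_const C_diff_mult)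

text \<open>\<open>F\<close> needs a derivative only at values taken by \<phi>, and
  \<open>F'\<close> is a function of the point instead of the value. An induction on the order can
  therefore feed in a derivative that is again an expression in \<phi>.\<close>

lemma C_diff_chain:
  fixes \<phi> :: "'a::euclidean_space \<Rightarrow> real"
  assumes \<phi>: "C_diff (Suc j) \<phi>"
    and F: "\<And>x. (F has_field_derivative F' x) (at (\<phi> x))"
    and F': "C_diff j F'"
  shows "C_diff (Suc j) (\<lambda>x. F (\<phi> x))"
proof (rule C_diff_SucI)
  show "((\<lambda>x. F (\<phi> x)) has_derivative (\<lambda>h. F' x * frechet_derivative \<phi> (at x) h)) (at x)" for x
    using has_derivative_compose[OF C_diff_has_derivative[OF \<phi>] has_field_derivative_imp_has_derivative[OF F]]
    by simp
  show "b \<in> Basis \<Longrightarrow> C_diff j (\<lambda>x. F' x * frechet_derivative \<phi> (at x) b)" for b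
    using \<phi> F' by (intro C_diff_mult) auto
qed

text \<open>The derivative of the inverse is a polynomial in the inverse itself, so the induction on
  the order closes.\<close>

lemma C_diff_inverse:
  fixes \<phi> :: "'a::euclidean_space \<Rightarrow> real"
  assumes "\<And>x. \<phi> x > 0" "C_diff j \<phi>"
  shows "C_diff j (\<lambda>x. inverse (\<phi> x))"
  using assms(2)
proof (induction j)
  case 0
  then show ?case using assms(1) by (auto intro!: continuous_intros simp: less_imp_neq[symmetric])
next
  case (Suc j)
  show ?case
  proof (rule C_diff_chain[OF Suc.prems])
    show "(inverse has_field_derivative (-1) * (inverse (\<phi> x) * inverse (\<phi> x))) (at (\<phi> x))" for x
      using DERIV_inverse[of "\<phi> x"] assms(1)[of x] by (simp add: power2_eq_square)
    show "C_diff j (\<lambda>x. (-1) * (inverse (\<phi> x) * inverse (\<phi> x)))"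
      by (intro C_diff_mult C_diff_const Suc.IH C_diff_SucD[OF Suc.prems])
  qed
qed

text \<open>The derivative is half the inverse of the root, so the induction hypothesis combines
  with \<open>C_diff_inverse\<close>.\<close>

lemma C_diff_sqrt:
  fixes \<phi> :: "'a::euclidean_space \<Rightarrow> real"
  assumes "\<And>x. \<phi> x > 0" "C_diff j \<phi>"
  shows "C_diff j (\<lambda>x. sqrt (\<phi> x))"
  using assms(2)
proof (induction j)
  case 0
  then show ?case by (auto intro!: continuous_intros)
next
  case (Suc j)
  show ?case
  proof (rule C_diff_chain[OF Suc.prems])
    show "(sqrt has_field_derivative inverse (sqrt (\<phi> x)) * (1/2)) (at (\<phi> x))" for x
      using DERIV_real_sqrt[OF assms(1)[of x]] by simp
    show "C_diff j (\<lambda>x. inverse (sqrt (\<phi> x)) * (1/2))"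
      using assms(1) by (intro C_diff_mult C_diff_const C_diff_inverse Suc.IH C_diff_SucD[OF Suc.prems]) auto
  qed
qed

text \<open>Index 0 is the standard smooth function that is flat at 0. The higher indices are there
  because the linear span of the whole family is closed under differentiation.\<close>

definition flat_exp :: "nat \<Rightarrow> real \<Rightarrow> real" where
  "flat_exp m t = (if t > 0 then inverse t ^ m * exp (- inverse t) else 0)"

text \<open>With s the inverse of t this is the decay of s^m / exp s at infinity.\<close>

lemma flat_exp_at_right_0: "(flat_exp m \<longlongrightarrow> 0) (at_right 0)"
proof -
  have "((\<lambda>t. inverse t ^ m / exp (inverse t)) \<longlongrightarrow> (0::real)) (at_right 0)"
    using tendsto_power_div_exp_0 filterlim_inverse_at_top_right by (rule filterlim_compose)
  then show ?thesis
    by (rule Lim_transform_eventually)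
      (auto simp: flat_exp_def exp_minus divide_inverse intro!: eventually_at_rightI[of 0 1])
qed

lemma flat_exp_has_derivative:
  "(flat_exp m has_field_derivative (- real m * flat_exp (Suc m) t + flat_exp (Suc (Suc m)) t)) (at t)"
proof -
  consider "t > 0" | "t < 0" | "t = 0" by linarith
  then show ?thesis
  proof cases
    case 1
    have "((\<lambda>t. inverse t ^ m * exp (- inverse t)) has_field_derivative
        (- real m * flat_exp (Suc m) t + flat_exp (Suc (Suc m)) t)) (at t)"
      using 1 by (cases m) (auto intro!: derivative_eq_intros simp: flat_exp_def field_simps,
          metis One_nat_def mult.commute neq0_conv power_minus_mult)
    then show ?thesis
      by (rule has_field_derivative_transform_within_open[of _ _ _ "{0<..}"])
        (use 1 in \<open>auto simp: flat_exp_def\<close>)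
  next
    case 2
    have "((\<lambda>t. 0) has_field_derivative (- real m * flat_exp (Suc m) t + flat_exp (Suc (Suc m)) t)) (at t)"
      using 2 by (auto simp: flat_exp_def)
    then show ?thesis
      by (rule has_field_derivative_transform_within_open[of _ _ _ "{..<0}"])
        (use 2 in \<open>auto simp: flat_exp_def\<close>)
  next
    case 3
    \<comment> \<open>To the right of 0 the difference quotient is \<open>flat_exp (Suc m)\<close>;
      to the left it is identically 0.\<close>
    have "((\<lambda>h. flat_exp m h / h) \<longlongrightarrow> 0) (at_right 0)"
      by (rule Lim_transform_eventually[OF flat_exp_at_right_0[of "Suc m"]])
        (auto simp: flat_exp_def field_simps intro!: eventually_at_rightI[of 0 1])
    moreover have "((\<lambda>h. flat_exp m h / h) \<longlongrightarrow> 0) (at_left 0)"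
      by (rule tendsto_eventually) (auto simp: flat_exp_def intro!: eventually_at_leftI[of "-1" 0])
    ultimately have "((\<lambda>h. flat_exp m h / h) \<longlongrightarrow> 0) (at 0)"
      by (simp add: filterlim_split_at)
    then show ?thesis
      using 3 by (simp add: DERIV_def flat_exp_def)
  qed
qed

text \<open>The induction must range over all \<open>m\<close> at once, since one derivative raises
  the index.\<close>

lemma C_diff_flat_exp:
  fixes \<phi> :: "'a::euclidean_space \<Rightarrow> real"
  assumes "C_diff j \<phi>"
  shows "C_diff j (\<lambda>x. flat_exp m (\<phi> x))"
  using assms
proof (induction j arbitrary: m)
  case 0
  have "continuous_on UNIV (flat_exp m)"
    using flat_exp_has_derivative by (intro continuous_at_imp_continuous_on ballI) (rule DERIV_isCont)
  then show ?case
    using 0 by (auto intro: continuous_on_compose2)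
next
  case (Suc j)
  show ?case
  proof (rule C_diff_chain[OF Suc.prems flat_exp_has_derivative])
    show "C_diff j (\<lambda>x. - real m * flat_exp (Suc m) (\<phi> x) + flat_exp (Suc (Suc m)) (\<phi> x))"
      by (intro C_diff_mult C_diff_add C_diff_const Suc.IH C_diff_SucD[OF Suc.prems])
  qed
qed

subsection \<open>Test functions\<close>

text \<open>Any compact set outside which the function vanishes will do, since the support is a
  closed subset of it. This spares computing the exact supports of sums, products and
  compositions.\<close>

lemma test_functionsI:
  assumes "\<And>j. C_diff j \<phi>" "compact K" "K \<subseteq> \<Omega>" "\<And>x. x \<notin> K \<Longrightarrow> \<phi> x = 0"
  shows "\<phi> \<in> test_functions \<Omega>"
proof -
  have "closure {x. \<phi> x \<noteq> 0} \<subseteq> K"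
    by (rule closure_minimal) (use assms compact_imp_closed in auto)
  moreover from this have "K \<inter> closure {x. \<phi> x \<noteq> 0} = closure {x. \<phi> x \<noteq> 0}"
    by blast
  then have "compact (closure {x. \<phi> x \<noteq> 0})"
    using compact_Int_closed[OF assms(2) closed_closure] by metis
  ultimately show ?thesis
    using assms(1,3) by (simp add: test_functions_def)
qed

lemma test_functionsE:
  assumes "\<phi> \<in> test_functions \<Omega>"
  obtains K where "\<And>j. C_diff j \<phi>" "compact K" "K \<subseteq> \<Omega>" "\<And>x. x \<notin> K \<Longrightarrow> \<phi> x = 0"
proof (rule that)
  show "\<And>x. x \<notin> closure {x. \<phi> x \<noteq> 0} \<Longrightarrow> \<phi> x = 0"
    using closure_subset[of "{x. \<phi> x \<noteq> 0}"] by blast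
qed (use assms in \<open>auto simp: test_functions_def\<close>)

lemma test_functions_outside: "\<phi> \<in> test_functions \<Omega> \<Longrightarrow> x \<notin> \<Omega> \<Longrightarrow> \<phi> x = 0"
  by (metis subsetD test_functionsE)

lemma test_functions_C_diff: "\<phi> \<in> test_functions \<Omega> \<Longrightarrow> C_diff j \<phi>"
  by (auto simp: test_functions_def)

lemma test_functions_zero: "(\<lambda>x. 0) \<in> test_functions \<Omega>"
  by (rule test_functionsI[where K = "{}"]) (auto intro: C_diff_const)

lemma test_functions_add:
  assumes "\<phi> \<in> test_functions \<Omega>" "\<psi> \<in> test_functions \<Omega>"
  shows "(\<lambda>x. \<phi> x + \<psi> x) \<in> test_functions \<Omega>"
proof -
  obtain K where K: "compact K" "K \<subseteq> \<Omega>" "\<And>x. x \<notin> K \<Longrightarrow> \<phi> x = 0"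
    using assms(1) by (rule test_functionsE) blast
  obtain L where L: "compact L" "L \<subseteq> \<Omega>" "\<And>x. x \<notin> L \<Longrightarrow> \<psi> x = 0"
    using assms(2) by (rule test_functionsE) blast
  show ?thesis
    by (rule test_functionsI[where K = "K \<union> L"])
      (use assms K L in \<open>auto intro: C_diff_add test_functions_C_diff\<close>)
qed

lemma test_functions_mult:
  assumes "\<phi> \<in> test_functions \<Omega>" "\<And>j. C_diff j \<psi>"
  shows "(\<lambda>x. \<psi> x * \<phi> x) \<in> test_functions \<Omega>"
  using assms(1)
  by (rule test_functionsE)
    (rule test_functionsI, auto intro: C_diff_mult assms test_functions_C_diff[OF assms(1)])

lemma test_functions_frechet_derivative:
  assumes "\<phi> \<in> test_functions \<Omega>" "b \<in> Basis"
  shows "(\<lambda>x. frechet_derivative \<phi> (at x) b) \<in> test_functions \<Omega>"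
proof -
  obtain K where K: "compact K" "K \<subseteq> \<Omega>" "\<And>x. x \<notin> K \<Longrightarrow> \<phi> x = 0"
    using assms(1) by (rule test_functionsE) blast
  show ?thesis
  proof (rule test_functionsI[OF _ K(1,2)])
    show "C_diff j (\<lambda>x. frechet_derivative \<phi> (at x) b)" for j
      using test_functions_C_diff[OF assms(1), of "Suc j"] assms(2) by simp
    fix x assume "x \<notin> K"
    \<comment> \<open>The complement of \<open>K\<close> is an open neighbourhood of
      \<open>x\<close> on which \<phi> is identically 0.\<close>
    have "(\<phi> has_derivative (\<lambda>h. 0)) (at x)"
      by (rule has_derivative_transform_within_open[where f = "\<lambda>x. 0" and s = "- K"])
        (use K \<open>x \<notin> K\<close> compact_imp_closed in auto)
    then show "frechet_derivative \<phi> (at x) b = 0"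
      using frechet_derivative_at by metis
  qed
qed

lemma test_functions_has_derivative:
  "\<phi> \<in> test_functions \<Omega> \<Longrightarrow> (\<phi> has_derivative frechet_derivative \<phi> (at x)) (at x)"
  using C_diff_has_derivative test_functions_C_diff by blast

lemma continuous_on_test_functions: "\<phi> \<in> test_functions \<Omega> \<Longrightarrow> continuous_on S \<phi>"
  using test_functions_C_diff[of \<phi> \<Omega> 0] by (auto intro: continuous_on_subset)

section \<open>Gradients of test functions\<close>

lemma grad_inner_Basis: "b \<in> Basis \<Longrightarrow> grad \<phi> x \<bullet> b = frechet_derivative \<phi> (at x) b"
  unfolding grad_def by simp

lemma grad_eqI:
  assumes "(\<phi> has_derivative (\<lambda>h. g \<bullet> h)) (at x)"
  shows "grad \<phi> x = g"
  using frechet_derivative_at[OF assms, symmetric] by (simp add: grad_def euclidean_representation)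

lemma frechet_derivative_eq_grad:
  assumes "\<phi> \<in> test_functions \<Omega>"
  shows "frechet_derivative \<phi> (at x) = (\<lambda>h. grad \<phi> x \<bullet> h)"
proof
  fix h
  interpret linear "frechet_derivative \<phi> (at x)"
    using test_functions_has_derivative[OF assms] has_derivative_linear by blast
  show "frechet_derivative \<phi> (at x) h = grad \<phi> x \<bullet> h"
    using arg_cong[OF euclidean_representation[of h], of "frechet_derivative \<phi> (at x)"]
    by (simp add: sum scale grad_def inner_sum_left inner_sum_right inner_commute mult.commute)
qed

lemma grad_add_scale:
  assumes "\<phi> \<in> test_functions \<Omega>" "\<psi> \<in> test_functions \<Omega>"
  shows "grad (\<lambda>x. \<phi> x + c * \<psi> x) x = grad \<phi> x + c *\<^sub>R grad \<psi> x"
  by (rule grad_eqI)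
    (auto intro!: derivative_eq_intros test_functions_has_derivative[OF assms(1)]
       test_functions_has_derivative[OF assms(2)]
      simp: frechet_derivative_eq_grad[OF assms(1)] frechet_derivative_eq_grad[OF assms(2)] inner_add_left)

text \<open>The smooth approximations \<open>sqrt (t\<^sup>2 + \<epsilon>\<^sup>2) - \<epsilon>\<close> of \<open>\<bar>t\<bar>\<close> vanish at \<open>0\<close>, hence preserve
  test functions.\<close>

lemma test_functions_smooth_abs:
  assumes \<phi>: "\<phi> \<in> test_functions \<Omega>" and e: "e > 0"
  shows "(\<lambda>x. sqrt ((\<phi> x)\<^sup>2 + e\<^sup>2) - e) \<in> test_functions \<Omega>"
    and "grad (\<lambda>x. sqrt ((\<phi> x)\<^sup>2 + e\<^sup>2) - e) x = (\<phi> x / sqrt ((\<phi> x)\<^sup>2 + e\<^sup>2)) *\<^sub>R grad \<phi> x"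
proof -
  have pos: "(\<phi> x)\<^sup>2 + e\<^sup>2 > 0" for x
    using e by (intro add_nonneg_pos) auto
  obtain K where K: "compact K" "K \<subseteq> \<Omega>" "\<And>x. x \<notin> K \<Longrightarrow> \<phi> x = 0"
    using assms(1) by (rule test_functionsE) blast
  show "(\<lambda>x. sqrt ((\<phi> x)\<^sup>2 + e\<^sup>2) - e) \<in> test_functions \<Omega>"
  proof (rule test_functionsI[OF _ K(1,2)])
    show "C_diff j (\<lambda>x. sqrt ((\<phi> x)\<^sup>2 + e\<^sup>2) - e)" for j
      by (intro C_diff_diff C_diff_sqrt C_diff_const pos)
        (auto simp: power2_eq_square intro!: C_diff_add C_diff_mult C_diff_const test_functions_C_diff[OF \<phi>])
  qed (use K e in auto)
  have s: "sqrt ((\<phi> x)\<^sup>2 + e\<^sup>2) > 0"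
    using pos by simp
  show "grad (\<lambda>x. sqrt ((\<phi> x)\<^sup>2 + e\<^sup>2) - e) x = (\<phi> x / sqrt ((\<phi> x)\<^sup>2 + e\<^sup>2)) *\<^sub>R grad \<phi> x"
    by (rule grad_eqI)
      (use pos[of x] s in \<open>auto intro!: derivative_eq_intros test_functions_has_derivative[OF \<phi>]
        simp: frechet_derivative_eq_grad[OF \<phi>] field_simps\<close>)
qed

text \<open>The product \<beta> of flat functions is positive exactly on the open box, so \<beta> /
  (\<beta> + 1/(n+1)) lies between 0 and 1 and tends to the indicator. The closed box serves as the
  compact carrier.\<close>

lemma box_cutoff:
  fixes a c :: "'a::euclidean_space"
  assumes "cbox a c \<subseteq> \<Omega>"
  obtains T :: "nat \<Rightarrow> 'a \<Rightarrow> real" where "\<And>n. T n \<in> test_functions \<Omega>"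
    "\<And>n x. \<bar>T n x\<bar> \<le> indicator (box a c) x" "\<And>x. (\<lambda>n. T n x) \<longlonglongrightarrow> indicator (box a c) x"
proof -
  define \<beta> where "\<beta> = (\<lambda>x. \<Prod>b\<in>Basis. flat_exp 0 (x \<bullet> b - a \<bullet> b) * flat_exp 0 (c \<bullet> b - x \<bullet> b))"
  define T where "T = (\<lambda>n x. inverse (\<beta> x + inverse (real (Suc n))) * \<beta> x)"
  have \<beta>_in: "\<beta> x > 0" if "x \<in> box a c" for x
    using that by (auto simp: \<beta>_def flat_exp_def mem_box intro!: prod_pos)
  have \<beta>_out: "\<beta> x = 0" if "x \<notin> box a c" for x
    using that by (auto simp: \<beta>_def flat_exp_def mem_box)
  have \<beta>_nonneg: "\<beta> x \<ge> 0" for x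
    using \<beta>_in[of x] \<beta>_out[of x] by (cases "x \<in> box a c") auto
  have \<beta>: "C_diff j \<beta>" for j
    unfolding \<beta>_def by (intro C_diff_prod C_diff_mult C_diff_flat_exp C_diff_diff C_diff_inner C_diff_const) auto
  have pos: "\<beta> x + inverse (real (Suc n)) > 0" for n x
    using \<beta>_nonneg[of x] by (simp add: add_nonneg_pos)
  show ?thesis
  proof
    show "T n \<in> test_functions \<Omega>" for n
    proof (rule test_functionsI[of _ "cbox a c"])
      show "C_diff j (T n)" for j
        unfolding T_def by (intro C_diff_mult C_diff_inverse \<beta> C_diff_add C_diff_const pos)
      show "T n x = 0" if "x \<notin> cbox a c" for x
        using that box_subset_cbox[of a c] \<beta>_out[of x] by (auto simp: T_def)
    qed (use assms in auto)
    show "\<bar>T n x\<bar> \<le> indicator (box a c) x" for n x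
    proof (cases "x \<in> box a c")
      case True
      have "T n x = \<beta> x / (\<beta> x + inverse (real (Suc n)))"
        by (simp add: T_def divide_inverse mult.commute)
      moreover have "\<dots> \<le> 1" "\<dots> \<ge> 0"
        using pos[of x n] \<beta>_nonneg[of x] by (auto simp: divide_le_eq_1)
      ultimately show ?thesis using True by (simp del: abs_divide)
    qed (simp add: T_def \<beta>_out)
    show "(\<lambda>n. T n x) \<longlonglongrightarrow> indicator (box a c) x" for x
    proof (cases "x \<in> box a c")
      case True
      have "(\<lambda>n. T n x) \<longlonglongrightarrow> inverse (\<beta> x + 0) * \<beta> x"
        unfolding T_def using \<beta>_in[OF True] by (intro tendsto_intros LIMSEQ_inverse_real_of_nat) auto
      then show ?thesis using True \<beta>_in[OF True] by simp
    qed (simp add: T_def \<beta>_out)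
  qed
qed

subsection \<open>Integration by parts and the fundamental lemma\<close>

lemma integrable_continuous_compact_support:
  fixes g :: "'a::euclidean_space \<Rightarrow> 'b::{banach, second_countable_topology}"
  assumes "continuous_on UNIV g" "compact K" "\<And>x. x \<notin> K \<Longrightarrow> g x = 0"
  shows "integrable lborel g"
proof -
  have "integrable lborel (\<lambda>x. indicator K x *\<^sub>R g x)"
    using assms continuous_on_subset by (intro borel_integrable_compact) blast+
  also have "(\<lambda>x. indicator K x *\<^sub>R g x) = g"
    using assms(3) by (auto simp: indicator_def)
  finally show ?thesis .
qed

lemma test_functions_borel_measurable: "\<phi> \<in> test_functions \<Omega> \<Longrightarrow> \<phi> \<in> borel_measurable borel"
  by (intro borel_measurable_continuous_onI continuous_on_test_functions)

lemma test_functions_integrable: "\<phi> \<in> test_functions \<Omega> \<Longrightarrow> integrable lborel \<phi>"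
  by (erule test_functionsE, rule integrable_continuous_compact_support[of \<phi>])
    (use C_diff.simps(1) in blast)+

lemma test_functions_bounded:
  assumes "\<phi> \<in> test_functions \<Omega>"
  obtains B where "\<And>x. \<bar>\<phi> x\<bar> \<le> B" "B \<ge> 0"
proof -
  obtain K where K: "compact K" "K \<subseteq> \<Omega>" "\<And>x. x \<notin> K \<Longrightarrow> \<phi> x = 0"
    using assms by (rule test_functionsE) blast
  have "bounded (\<phi> ` K)"
    by (intro compact_imp_bounded compact_continuous_image K continuous_on_test_functions[OF assms])
  then obtain B where B: "\<And>x. x \<in> K \<Longrightarrow> norm (\<phi> x) \<le> B" "B > 0"
    unfolding bounded_pos by auto
  show ?thesis
  proof (rule that)
    show "\<bar>\<phi> x\<bar> \<le> B" for x
      using B K(3)[of x] by (cases "x \<in> K") auto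
  qed (use B in auto)
qed

lemma lborel_integral_translate:
  fixes f :: "'a::euclidean_space \<Rightarrow> real"
  assumes [measurable]: "f \<in> borel_measurable borel"
  shows "(\<integral>x. f (c + x) \<partial>lborel) = (\<integral>x. f x \<partial>lborel)"
    and "integrable lborel (\<lambda>x. f (c + x)) \<longleftrightarrow> integrable lborel f"
proof -
  have "(\<integral>x. f x \<partial>distr lborel borel ((+) c)) = (\<integral>x. f (c + x) \<partial>lborel)"
    by (rule integral_distr) auto
  then show "(\<integral>x. f (c + x) \<partial>lborel) = (\<integral>x. f x \<partial>lborel)"
    by (simp add: lborel_distr_plus)
  have "integrable (distr lborel borel ((+) c)) f \<longleftrightarrow> integrable lborel (\<lambda>x. f (c + x))"
    by (rule integrable_distr_eq) auto
  then show "integrable lborel (\<lambda>x. f (c + x)) \<longleftrightarrow> integrable lborel f"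
    by (simp add: lborel_distr_plus)
qed

text \<open>By translation invariance the difference quotients integrate to zero.\<close>

lemma integral_frechet_derivative_test_function:
  assumes \<eta>: "\<eta> \<in> test_functions \<Omega>" and b: "b \<in> Basis"
  shows "(\<integral>x. frechet_derivative \<eta> (at x) b \<partial>lborel) = 0"
proof -
  let ?D = "\<lambda>x. frechet_derivative \<eta> (at x) b"
  define t where "t = (\<lambda>n. inverse (real (Suc n)))"
  define s where "s = (\<lambda>n x. (\<eta> (t n *\<^sub>R b + x) - \<eta> x) / t n)"
  have t: "0 < t n" "t n \<le> 1" for n
    by (auto simp: t_def inverse_le_1_iff)
  have [measurable]: "\<eta> \<in> borel_measurable borel"
    using \<eta> by (rule test_functions_borel_measurable)
  obtain K where K: "compact K" "K \<subseteq> \<Omega>" "\<And>x. x \<notin> K \<Longrightarrow> \<eta> x = 0"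
    using \<eta> by (rule test_functionsE) blast
  obtain R where R: "\<And>x. x \<in> K \<Longrightarrow> norm x \<le> R"
    using compact_imp_bounded[OF K(1)] by (auto simp: bounded_iff)
  obtain B where B: "\<And>x. \<bar>?D x\<bar> \<le> B" "B \<ge> 0"
    using test_functions_bounded[OF test_functions_frechet_derivative[OF \<eta> b]] by blast
  have line: "((\<lambda>r. \<eta> (r *\<^sub>R b + x)) has_field_derivative ?D (r *\<^sub>R b + x)) (at r)" for r x
  proof -
    have "((\<lambda>r. r *\<^sub>R b + x) has_derivative (\<lambda>h. h *\<^sub>R b)) (at r)"
      by (auto intro!: derivative_eq_intros)
    then have "((\<lambda>r. \<eta> (r *\<^sub>R b + x)) has_derivative
        (\<lambda>h. frechet_derivative \<eta> (at (r *\<^sub>R b + x)) (h *\<^sub>R b))) (at r)"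
      by (rule has_derivative_compose) (rule test_functions_has_derivative[OF \<eta>])
    then show ?thesis
      by (simp add: has_field_derivative_def frechet_derivative_eq_grad[OF \<eta>] mult_commute_abs)
  qed
  have lim: "(\<lambda>n. s n x) \<longlonglongrightarrow> ?D x" for x
  proof -
    have "((\<lambda>h. (\<eta> (h *\<^sub>R b + x) - \<eta> x) / h) \<longlongrightarrow> ?D x) (at 0)"
      using line[of x 0] by (simp add: DERIV_def)
    moreover have "filterlim t (at 0) sequentially"
      unfolding t_def using LIMSEQ_inverse_real_of_nat by (auto simp: filterlim_at)
    ultimately show ?thesis
      unfolding s_def by (rule filterlim_compose)
  qed
  \<comment> \<open>The mean value theorem along \<open>b\<close> turns a quotient into a value of
    \<open>?D\<close>, bounded by \<open>B\<close>. As \<open>t n\<close> is at most 1 and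
    \<open>b\<close> is a unit vector, both evaluation points miss \<open>K\<close> once
    \<open>x\<close> lies outside the ball of radius \<open>R + 1\<close>.\<close>
  have bd: "norm (s n x) \<le> B * indicator (cball 0 (R + 1)) x" for n x
  proof (cases "x \<in> cball 0 (R + 1)")
    case True
    obtain z where "\<eta> (t n *\<^sub>R b + x) - \<eta> (0 *\<^sub>R b + x) = (t n - 0) * ?D (z *\<^sub>R b + x)"
      using MVT2[OF t(1)[of n] line] by blast
    then have "s n x = ?D (z *\<^sub>R b + x)"
      using t(1)[of n] by (simp add: s_def field_simps)
    then show ?thesis using B True by simp
  next
    case False
    have "x \<notin> K" using False R[of x] by auto
    moreover have "t n *\<^sub>R b + x \<notin> K"
    proof
      assume "t n *\<^sub>R b + x \<in> K"
      then have "norm (t n *\<^sub>R b + x) \<le> R" by (rule R)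
      moreover have "norm x \<le> norm (t n *\<^sub>R b + x) + norm (t n *\<^sub>R b)"
        by (metis add.commute norm_triangle_sub add_diff_cancel_left' norm_minus_commute)
      moreover have "norm (t n *\<^sub>R b) \<le> 1" using t[of n] b by simp
      ultimately show False using False by simp
    qed
    ultimately show ?thesis using K False by (simp add: s_def)
  qed
  have "(\<lambda>n. \<integral>x. s n x \<partial>lborel) \<longlonglongrightarrow> (\<integral>x. ?D x \<partial>lborel)"
  proof (rule integral_dominated_convergence)
    show "integrable lborel (\<lambda>x. B * indicator (cball 0 (R + 1)) x :: real)"
      by (intro integrable_mult_right integrable_real_indicator) (auto intro: emeasure_bounded_finite[OF bounded_cball, unfolded infinity_ennreal_def])
  qed (use lim bd test_functions_borel_measurable[OF test_functions_frechet_derivative[OF \<eta> b]]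
      in \<open>auto simp: s_def\<close>)
  moreover have "(\<integral>x. s n x \<partial>lborel) = 0" for n
    unfolding s_def using test_functions_integrable[OF \<eta>]
    by (simp add: lborel_integral_translate)
  ultimately show ?thesis by (simp add: LIMSEQ_const_iff)
qed

text \<open>The product of the two is a test function, so the integral of its derivative is zero;
  the product rule does the rest.\<close>

lemma test_functions_parts:
  assumes \<phi>: "\<phi> \<in> test_functions \<Omega>" and \<psi>: "\<psi> \<in> test_functions \<Omega>" and b: "b \<in> Basis"
  shows "(\<integral>x. \<phi> x * frechet_derivative \<psi> (at x) b \<partial>lborel) =
    - (\<integral>x. frechet_derivative \<phi> (at x) b * \<psi> x \<partial>lborel)"
proof -
  have "((\<lambda>x. \<phi> x * \<psi> x) has_derivative
      (\<lambda>h. \<phi> x * frechet_derivative \<psi> (at x) h + frechet_derivative \<phi> (at x) h * \<psi> x)) (at x)" for x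
    by (intro has_derivative_mult test_functions_has_derivative[OF \<phi>] test_functions_has_derivative[OF \<psi>])
  from frechet_derivative_at[OF this]
  have D: "frechet_derivative (\<lambda>x. \<phi> x * \<psi> x) (at x) b =
      \<phi> x * frechet_derivative \<psi> (at x) b + frechet_derivative \<phi> (at x) b * \<psi> x" for x
    by metis
  have "(\<lambda>x. \<phi> x * \<psi> x) \<in> test_functions \<Omega>"
    using \<psi> test_functions_C_diff[OF \<phi>] by (rule test_functions_mult)
  from integral_frechet_derivative_test_function[OF this b]
  have "(\<integral>x. \<phi> x * frechet_derivative \<psi> (at x) b + frechet_derivative \<phi> (at x) b * \<psi> x \<partial>lborel) = 0"
    by (simp add: D)
  moreover have "integrable lborel (\<lambda>x. \<phi> x * frechet_derivative \<psi> (at x) b)"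
    by (intro test_functions_integrable[of _ \<Omega>] test_functions_mult test_functions_frechet_derivative
        test_functions_C_diff[OF \<phi>] \<psi> b)
  moreover have "integrable lborel (\<lambda>x. frechet_derivative \<phi> (at x) b * \<psi> x)"
    by (intro test_functions_integrable[of _ \<Omega>] test_functions_mult \<psi>
        test_functions_C_diff[OF test_functions_frechet_derivative[OF \<phi> b]])
  ultimately show ?thesis by simp
qed

lemma integral_lebesgue_on_zero_outside:
  fixes f :: "'a::euclidean_space \<Rightarrow> 'b::{banach, second_countable_topology}"
  assumes "\<Omega> \<in> sets lebesgue" "\<And>x. x \<notin> \<Omega> \<Longrightarrow> f x = 0"
  shows "(\<integral>x. f x \<partial>lebesgue_on \<Omega>) = (\<integral>x. f x \<partial>lebesgue)"
    and "integrable (lebesgue_on \<Omega>) f \<longleftrightarrow> integrable lebesgue f"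
proof -
  have "(\<lambda>x. indicator \<Omega> x *\<^sub>R f x) = f"
    using assms(2) by (auto simp: indicator_def)
  then show "(\<integral>x. f x \<partial>lebesgue_on \<Omega>) = (\<integral>x. f x \<partial>lebesgue)"
    and "integrable (lebesgue_on \<Omega>) f \<longleftrightarrow> integrable lebesgue f"
    using assms(1) by (auto simp: integral_restrict_space integrable_restrict_space)
qed

lemma test_functions_lebesgue_on:
  fixes \<phi> :: "'a::euclidean_space \<Rightarrow> real"
  assumes "open \<Omega>" "\<phi> \<in> test_functions \<Omega>"
  shows "(\<integral>x. \<phi> x \<partial>lebesgue_on \<Omega>) = (\<integral>x. \<phi> x \<partial>lborel)"
    and "integrable (lebesgue_on \<Omega>) \<phi>"
proof -
  have z: "\<phi> x = 0" if "x \<notin> \<Omega>" for x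
    using assms(2) that by (rule test_functions_outside)
  have m: "\<phi> \<in> borel_measurable lborel"
    using test_functions_borel_measurable[OF assms(2)] by simp
  have \<Omega>: "\<Omega> \<in> sets lebesgue" using assms(1) by auto
  show "(\<integral>x. \<phi> x \<partial>lebesgue_on \<Omega>) = (\<integral>x. \<phi> x \<partial>lborel)"
    using integral_lebesgue_on_zero_outside(1)[of \<Omega> \<phi>] \<Omega> z m by (simp add: integral_completion)
  show "integrable (lebesgue_on \<Omega>) \<phi>"
    using integral_lebesgue_on_zero_outside(2)[of \<Omega> \<phi>] \<Omega> z m test_functions_integrable[OF assms(2)]
    by (simp add: integrable_completion)
qed

text \<open>A test function is bounded by some \<open>B\<close> and vanishes off a compact
  \<open>K\<close>, so the product is dominated by \<open>B\<close> times \<open>h\<close> cut off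
  to \<open>K\<close>.\<close>

lemma locally_integrable_mult_test_function:
  fixes h :: "'a::euclidean_space \<Rightarrow> real"
  assumes "open \<Omega>" "locally_integrable \<Omega> h" "\<phi> \<in> test_functions \<Omega>"
  shows "integrable (lebesgue_on \<Omega>) (\<lambda>x. h x * \<phi> x)"
proof -
  obtain K where K: "compact K" "K \<subseteq> \<Omega>" "\<And>x. x \<notin> K \<Longrightarrow> \<phi> x = 0"
    using assms(3) by (rule test_functionsE) blast
  obtain B where B: "\<And>x. \<bar>\<phi> x\<bar> \<le> B" "B \<ge> 0"
    using test_functions_bounded[OF assms(3)] by blast
  have [measurable]: "K \<in> sets lebesgue"
    using K(1) by (simp add: borel_compact)
  have i: "integrable lebesgue (\<lambda>x. indicator K x * h x)"
    using assms(2) K unfolding locally_integrable_def by (auto simp: integrable_restrict_space)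
  have [measurable]: "\<phi> \<in> borel_measurable lebesgue"
    using test_functions_borel_measurable[OF assms(3)] by (simp add: measurable_completion)
  have "integrable lebesgue (\<lambda>x. (indicator K x * h x) * \<phi> x)"
  proof (rule Bochner_Integration.integrable_bound)
    show "integrable lebesgue (\<lambda>x. B * (indicator K x * h x))"
      using i by simp
    show "(\<lambda>x. (indicator K x * h x) * \<phi> x) \<in> borel_measurable lebesgue"
      by (intro borel_measurable_times borel_measurable_integrable[OF i]) auto
    show "AE x in lebesgue. norm ((indicator K x * h x) * \<phi> x) \<le> norm (B * (indicator K x * h x))"
    proof (rule AE_I2)
      fix x
      show "norm ((indicator K x * h x) * \<phi> x) \<le> norm (B * (indicator K x * h x))"
        using mult_left_mono[OF B(1)[of x] abs_ge_zero[of "indicator K x * h x"]] B(2)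
        by (simp only: real_norm_def abs_mult abs_of_nonneg mult.commute abs_ge_zero)
    qed
  qed
  moreover have "(\<lambda>x. (indicator K x * h x) * \<phi> x) = (\<lambda>x. h x * \<phi> x)"
    using K(3) by (auto simp: indicator_def fun_eq_iff)
  ultimately show ?thesis
    using assms(1) K by (subst integral_lebesgue_on_zero_outside(2)) auto
qed

text \<open>Boxes are stable under intersection and generate the Borel sets; the sets over which
  \<open>g\<close> integrates to 0 form a Dynkin system. The hypothesis on the full integral pays
  for complements.\<close>

lemma AE_zero_if_box_integrals_zero:
  fixes g :: "'a::euclidean_space \<Rightarrow> real"
  assumes g: "integrable lborel g"
    and box: "\<And>a c. (\<integral>x. indicator (box a c) x * g x \<partial>lborel) = 0"
    and UNIV: "(\<integral>x. g x \<partial>lborel) = 0"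
  shows "AE x in lborel. g x = 0"
proof (rule density_unique_real[OF g])
  fix A :: "'a set" assume "A \<in> sets lborel"
  have int: "integrable lborel (\<lambda>x. indicator A x * g x)" if "A \<in> sets borel" for A
    using integrable_mult_indicator[OF _ g, of A] that by simp
  have "Int_stable (range (\<lambda>(a, b). box a b :: 'a set))"
    by (auto simp: Int_stable_def box_Int_box)
  moreover have "range (\<lambda>(a, b). box a b :: 'a set) \<subseteq> Pow UNIV"
    by auto
  moreover have "A \<in> sigma_sets UNIV (range (\<lambda>(a, b). box a b))"
    using \<open>A \<in> sets lborel\<close> by (simp add: borel_eq_box)
  ultimately have "(\<integral>x. indicator A x * g x \<partial>lborel) = 0"
  proof (induction rule: sigma_sets_induct_disjoint)
    case (basic A)
    then show ?case using box by auto
  next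
    case (compl A)
    then have "A \<in> sets borel" by (simp add: borel_eq_box)
    moreover have "indicator (UNIV - A) x * g x = g x - indicator A x * g x" for x
      by (auto simp: indicator_def)
    ultimately show ?case using compl UNIV int g by simp
  next
    case (union A)
    then have A: "A i \<in> sets borel" for i by (auto simp: borel_eq_box)
    then have U: "(\<Union>i. A i) \<in> sets borel" by auto
    have "(LINT x:(\<Union>i. A i)|lborel. g x) = (\<Sum>i. (LINT x:(A i)|lborel. g x))"
      by (rule lebesgue_integral_countable_add)
        (use A int[OF U] \<open>disjoint_family A\<close> in \<open>auto simp: disjoint_family_on_def set_integrable_def\<close>)
    then show ?case using union.IH by (simp add: set_lebesgue_integral_def)
  qed simp
  then show "(\<integral>x\<in>A. g x \<partial>lborel) = (\<integral>x\<in>A. 0 \<partial>lborel)"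
    by (simp add: set_lebesgue_integral_def)
qed simp

text \<open>Cutoffs show that \<open>h\<close> integrates to 0 over every open box whose closed box
  lies in \<Omega>. Hence \<open>h\<close> vanishes almost everywhere on each such closed box, and
  countably many of these cover \<Omega>.\<close>

lemma fundamental_lemma:
  fixes h :: "'a::euclidean_space \<Rightarrow> real"
  assumes \<Omega>: "open \<Omega>" and h: "locally_integrable \<Omega> h"
    and zero: "\<And>\<phi>. \<phi> \<in> test_functions \<Omega> \<Longrightarrow> (\<integral>x. h x * \<phi> x \<partial>lebesgue_on \<Omega>) = 0"
  shows "AE x in lebesgue_on \<Omega>. h x = 0"
proof -
  have box: "(\<integral>x. indicator (box a c) x * h x \<partial>lebesgue) = 0"
    and int: "integrable lebesgue (\<lambda>x. indicator (box a c) x * h x)" if "cbox a c \<subseteq> \<Omega>" for a c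
  proof -
    obtain T where T: "\<And>n. T n \<in> test_functions \<Omega>"
      "\<And>n x. \<bar>T n x\<bar> \<le> indicator (box a c) x" "\<And>x. (\<lambda>n. T n x) \<longlonglongrightarrow> indicator (box a c) x"
      using box_cutoff[OF \<open>cbox a c \<subseteq> \<Omega>\<close>] by metis
    have "integrable (lebesgue_on (cbox a c)) h"
      using h \<open>cbox a c \<subseteq> \<Omega>\<close> by (auto simp: locally_integrable_def)
    then have "integrable lebesgue (\<lambda>x. indicator (cbox a c) x * h x)"
      by (simp add: integrable_restrict_space)
    from integrable_mult_indicator[OF _ this, of "box a c"]
    have "integrable lebesgue (\<lambda>x. indicator (box a c) x * (indicator (cbox a c) x * h x))"
      by simp
    moreover have eq: "(\<lambda>x. indicator (box a c) x * (indicator (cbox a c) x * h x)) =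
        (\<lambda>x. indicator (box a c) x * h x)"
      using box_subset_cbox[of a c] by (auto simp: indicator_def fun_eq_iff)
    ultimately show i: "integrable lebesgue (\<lambda>x. indicator (box a c) x * h x)"
      by simp
    have T0: "T n x = 0" if "x \<notin> box a c" for n x
      using T(2)[of n x] that by simp
    have Th: "(\<lambda>x. T n x * h x) = (\<lambda>x. T n x * (indicator (box a c) x * h x))" for n
      using T0[of _ n] by (auto simp: indicator_def fun_eq_iff)
    have meas: "(\<lambda>x. T n x * h x) \<in> borel_measurable lebesgue" for n
      unfolding Th using test_functions_borel_measurable[OF T(1), of n]
      by (intro borel_measurable_times borel_measurable_integrable[OF i]) (simp add: measurable_completion)
    \<comment> \<open>The cutoffs vanish off the box, so the restriction of \<open>h\<close> to the
      box dominates every product.\<close>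
    have "(\<lambda>n. \<integral>x. T n x * h x \<partial>lebesgue) \<longlonglongrightarrow> (\<integral>x. indicator (box a c) x * h x \<partial>lebesgue)"
    proof (rule integral_dominated_convergence)
      show "integrable lebesgue (\<lambda>x. \<bar>indicator (box a c) x * h x\<bar>)"
        using i by simp
      show "AE x in lebesgue. norm (T n x * h x) \<le> \<bar>indicator (box a c) x * h x\<bar>" for n
        using T(2)[of n] by (auto simp: abs_mult intro!: AE_I2 mult_right_mono)
    qed (use i meas in \<open>auto intro!: tendsto_mult T(3)\<close>)
    moreover have "(\<integral>x. T n x * h x \<partial>lebesgue) = 0" for n
    proof -
      have "T n x * h x = 0" if "x \<notin> \<Omega>" for x
        using T0[of x n] that box_subset_cbox[of a c] \<open>cbox a c \<subseteq> \<Omega>\<close> by auto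
      then have "(\<integral>x. T n x * h x \<partial>lebesgue_on \<Omega>) = (\<integral>x. T n x * h x \<partial>lebesgue)"
        using \<Omega> by (intro integral_lebesgue_on_zero_outside) auto
      then show ?thesis using zero[OF T(1), of n] by (simp add: mult.commute)
    qed
    ultimately show "(\<integral>x. indicator (box a c) x * h x \<partial>lebesgue) = 0"
      by (simp add: LIMSEQ_const_iff)
  qed
  have on_cbox: "AE x in lebesgue. x \<in> cbox a c \<longrightarrow> h x = 0" if ac: "cbox a c \<subseteq> \<Omega>" for a c
  proof -
    have "(\<lambda>x. indicator (box a c) x * h x) \<in> borel_measurable lebesgue"
      using int[OF ac] by auto
    \<comment> \<open>\<open>h\<close> is only Lebesgue measurable, while the Dynkin argument runs
      over Borel sets and \<open>lborel\<close>; hence the Borel version \<open>g\<close>.\<close>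
    from completion_ex_borel_measurable_real[OF this]
    obtain g where gm: "g \<in> borel_measurable lborel"
      and "AE x in lborel. indicator (box a c) x * h x = g x" by blast
    then have g: "AE x in lebesgue. indicator (box a c) x * h x = g x"
      by (auto intro: AE_completion)
    have [measurable]: "g \<in> borel_measurable lebesgue"
      using gm by (rule measurable_completion)
    have "integrable lebesgue g"
      by (rule integrable_cong_AE_imp[OF int[OF ac]]) (use g in \<open>auto elim!: eventually_mono\<close>)
    then have gi: "integrable lborel g"
      using gm by (simp add: integrable_completion)
    have gbox: "(\<integral>x. indicator (box a' c') x * g x \<partial>lborel) = 0" for a' c'
    proof -
      obtain a'' c'' where eq: "box a' c' \<inter> box a c = box a'' c''"
        using box_Int_box[of a' c' a c] by blast
      have "(\<integral>x. indicator (box a' c') x * g x \<partial>lborel) = (\<integral>x. indicator (box a' c') x * g x \<partial>lebesgue)"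
        using gm by (intro integral_completion[symmetric]) auto
      also have "\<dots> = (\<integral>x. indicator (box a' c') x * (indicator (box a c) x * h x) \<partial>lebesgue)"
      proof (rule integral_cong_AE)
        show "(\<lambda>x. indicator (box a' c') x * (indicator (box a c) x * h x)) \<in> borel_measurable lebesgue"
          by (rule borel_measurable_times[OF _ borel_measurable_integrable[OF int[OF ac]]])
            (auto intro!: borel_measurable_indicator)
        show "AE x in lebesgue. indicator (box a' c') x * g x =
            indicator (box a' c') x * (indicator (box a c) x * h x)"
          using g by eventually_elim simp
      qed (auto intro!: borel_measurable_times borel_measurable_indicator)
      also have "\<dots> = (\<integral>x. indicator (box a'' c'') x * h x \<partial>lebesgue)"
        by (simp add: eq[symmetric] indicator_inter_arith mult.assoc)
      also have "\<dots> = 0"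
      \<comment> \<open>Only for a nonempty open box is the closed box its closure, which keeps it
        inside \<open>cbox a c\<close>; a degenerate closed box could leave \<Omega>.\<close>
      proof (cases "box a'' c'' = {}")
        case False
        then have "cbox a'' c'' = closure (box a'' c'')"
          by (simp add: closure_box)
        also have "\<dots> \<subseteq> closure (box a c)"
          using eq by (intro closure_mono) auto
        also have "\<dots> \<subseteq> cbox a c"
          by (intro closure_minimal box_subset_cbox closed_cbox)
        finally show ?thesis using box ac by simp
      qed simp
      finally show ?thesis .
    qed
    have "(\<integral>x. g x \<partial>lborel) = (\<integral>x. g x \<partial>lebesgue)"
      using gm by (intro integral_completion[symmetric])
    also have "\<dots> = (\<integral>x. indicator (box a c) x * h x \<partial>lebesgue)"
      by (rule integral_cong_AE) (use g int[OF ac] in auto)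
    finally have "(\<integral>x. g x \<partial>lborel) = 0"
      using box[OF ac] by simp
    from AE_zero_if_box_integrals_zero[OF gi gbox this]
    have "AE x in lebesgue. g x = 0"
      by (rule AE_completion)
    \<comment> \<open>\<open>g\<close> represents \<open>h\<close> on the open box only, so the
      boundary has to be discarded as a null set.\<close>
    moreover have "AE x in lebesgue. x \<notin> cbox a c - box a c"
      using negligible_frontier_interval[of a c] by (intro AE_not_in) (simp add: negligible_iff_null_sets)
    ultimately show ?thesis
      using g by eventually_elim (auto simp: indicator_def split: if_splits)
  qed
  obtain \<D> where \<D>: "countable \<D>" "\<D> \<subseteq> Pow \<Omega>" "\<And>X. X \<in> \<D> \<Longrightarrow> \<exists>a b. X = cbox a b" "\<Union>\<D> = \<Omega>"
    using open_countable_Union_open_cbox[OF \<Omega>] by metis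
  have "AE x in lebesgue. \<forall>X\<in>\<D>. x \<in> X \<longrightarrow> h x = 0"
  proof (subst AE_ball_countable[OF \<D>(1)], rule ballI)
    fix X assume "X \<in> \<D>"
    then obtain a c where "X = cbox a c" "cbox a c \<subseteq> \<Omega>"
      using \<D>(2,3) by blast
    then show "AE x in lebesgue. x \<in> X \<longrightarrow> h x = 0"
      using on_cbox by simp
  qed
  then have "AE x in lebesgue. x \<in> \<Omega> \<longrightarrow> h x = 0"
    using \<D>(4) by (auto elim!: eventually_mono)
  then show ?thesis
    using \<Omega> by (simp add: AE_restrict_space_iff)
qed

section \<open>Uniqueness and differences of weak gradients\<close>

lemma locally_integrable_inner:
  "locally_integrable \<Omega> g \<Longrightarrow> locally_integrable \<Omega> (\<lambda>x. g x \<bullet> b)"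
  unfolding locally_integrable_def by (auto intro: integrable_inner_left)

lemma locally_integrable_diff:
  "locally_integrable \<Omega> g \<Longrightarrow> locally_integrable \<Omega> g' \<Longrightarrow> locally_integrable \<Omega> (\<lambda>x. g x - g' x)"
  unfolding locally_integrable_def by auto

text \<open>Each coordinate of the difference integrates to 0 against every test function. This is
  what frees the energies from the choice in \<open>weak_grad\<close>.\<close>

lemma has_weak_gradient_unique:
  assumes \<Omega>: "open \<Omega>" and g: "has_weak_gradient \<Omega> u g" and g': "has_weak_gradient \<Omega> u g'"
  shows "AE x in lebesgue_on \<Omega>. g x = g' x"
proof -
  have l: "locally_integrable \<Omega> (\<lambda>x. g x \<bullet> b)" "locally_integrable \<Omega> (\<lambda>x. g' x \<bullet> b)" for b
    using g g' by (auto simp: has_weak_gradient_def intro: locally_integrable_inner)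
  have "AE x in lebesgue_on \<Omega>. g x \<bullet> b - g' x \<bullet> b = 0" if b: "b \<in> Basis" for b
  proof (rule fundamental_lemma[OF \<Omega> locally_integrable_diff[OF l]])
    fix \<phi> assume \<phi>: "\<phi> \<in> test_functions \<Omega>"
    have "- (\<integral>x. (g x \<bullet> b) * \<phi> x \<partial>lebesgue_on \<Omega>) = - (\<integral>x. (g' x \<bullet> b) * \<phi> x \<partial>lebesgue_on \<Omega>)"
      using g[unfolded has_weak_gradient_def, THEN conjunct2, THEN conjunct2, rule_format, OF \<phi> b]
        g'[unfolded has_weak_gradient_def, THEN conjunct2, THEN conjunct2, rule_format, OF \<phi> b]
      by linarith
    then show "(\<integral>x. (g x \<bullet> b - g' x \<bullet> b) * \<phi> x \<partial>lebesgue_on \<Omega>) = 0"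
      using locally_integrable_mult_test_function[OF \<Omega> l(1) \<phi>]
        locally_integrable_mult_test_function[OF \<Omega> l(2) \<phi>]
      by (simp add: left_diff_distrib)
  qed
  then have "AE x in lebesgue_on \<Omega>. \<forall>b\<in>Basis. g x \<bullet> b - g' x \<bullet> b = 0"
    by (simp add: AE_finite_all)
  then show ?thesis
    by eventually_elim (simp add: euclidean_eq_iff[where 'a = 'a])
qed

text \<open>Needed because \<open>H10\<close> speaks of \<open>H1_norm\<close> of a difference,
  whose \<open>weak_grad\<close> is a fresh choice.\<close>

lemma has_weak_gradient_diff:
  assumes \<Omega>: "open \<Omega>" and g: "has_weak_gradient \<Omega> u g" and g': "has_weak_gradient \<Omega> u' g'"
  shows "has_weak_gradient \<Omega> (\<lambda>x. u x - u' x) (\<lambda>x. g x - g' x)"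
proof -
  have l: "locally_integrable \<Omega> u" "locally_integrable \<Omega> u'"
    "locally_integrable \<Omega> (\<lambda>x. g x \<bullet> b)" "locally_integrable \<Omega> (\<lambda>x. g' x \<bullet> b)" for b
    using g g' by (auto simp: has_weak_gradient_def intro: locally_integrable_inner)
  show ?thesis
    using g g' unfolding has_weak_gradient_def
    by (auto simp: locally_integrable_diff left_diff_distrib inner_diff_left
        locally_integrable_mult_test_function[OF \<Omega> l(1) test_functions_frechet_derivative]
        locally_integrable_mult_test_function[OF \<Omega> l(2) test_functions_frechet_derivative]
        locally_integrable_mult_test_function[OF \<Omega> l(3)]
        locally_integrable_mult_test_function[OF \<Omega> l(4)])
qed

subsection \<open>Square integrable functions\<close>

text \<open>The square of \<open>L2_norm\<close>, in which the parallelogram law and the energy are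
  linear expressions.\<close>

definition sq_norm :: "'a::euclidean_space set \<Rightarrow> ('a \<Rightarrow> 'b::euclidean_space) \<Rightarrow> real" where
  "sq_norm \<Omega> f = (\<integral>x. (norm (f x))\<^sup>2 \<partial>lebesgue_on \<Omega>)"

lemma sq_norm_nonneg: "0 \<le> sq_norm \<Omega> f"
  by (simp add: sq_norm_def)

lemma L2_norm_power2: "(L2_norm \<Omega> f)\<^sup>2 = sq_norm \<Omega> f"
  by (simp add: L2_norm_def sq_norm_def)

lemma L2_integrable: "f \<in> L2 \<Omega> \<Longrightarrow> integrable (lebesgue_on \<Omega>) (\<lambda>x. (norm (f x))\<^sup>2)"
  by (simp add: L2_def)

lemma L2_measurable: "f \<in> L2 \<Omega> \<Longrightarrow> f \<in> borel_measurable (lebesgue_on \<Omega>)"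
  by (simp add: L2_def)

lemma L2_bound:
  assumes "f \<in> L2 \<Omega>" "g \<in> borel_measurable (lebesgue_on \<Omega>)"
    and "\<And>x. norm (g x) \<le> B * norm (f x)"
  shows "g \<in> L2 \<Omega>"
proof -
  have "integrable (lebesgue_on \<Omega>) (\<lambda>x. (norm (g x))\<^sup>2)"
  proof (rule Bochner_Integration.integrable_bound)
    show "integrable (lebesgue_on \<Omega>) (\<lambda>x. B\<^sup>2 * (norm (f x))\<^sup>2)"
      using L2_integrable[OF assms(1)] by simp
    show "AE x in lebesgue_on \<Omega>. norm ((norm (g x))\<^sup>2) \<le> norm (B\<^sup>2 * (norm (f x))\<^sup>2)"
      using power_mono[OF assms(3) norm_ge_zero, of _ 2] by (simp add: power_mult_distrib)
  qed (use assms(2) in measurable)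
  then show ?thesis
    using assms(2) by (simp add: L2_def)
qed

lemma sq_norm_mono:
  assumes "f \<in> L2 \<Omega>" "g \<in> L2 \<Omega>" "\<And>x. norm (g x) \<le> norm (f x)"
  shows "sq_norm \<Omega> g \<le> sq_norm \<Omega> f"
  unfolding sq_norm_def
  by (intro integral_mono L2_integrable assms power_mono) auto

lemma L2_inner:
  assumes "f \<in> L2 \<Omega>" "g \<in> L2 \<Omega>"
  shows "integrable (lebesgue_on \<Omega>) (\<lambda>x. f x \<bullet> g x)"
proof (rule Bochner_Integration.integrable_bound)
  show "integrable (lebesgue_on \<Omega>) (\<lambda>x. (norm (f x))\<^sup>2 + (norm (g x))\<^sup>2)"
    using assms by (intro Bochner_Integration.integrable_add L2_integrable)
  show "(\<lambda>x. f x \<bullet> g x) \<in> borel_measurable (lebesgue_on \<Omega>)"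
    by (intro borel_measurable_inner L2_measurable assms)
  have "\<bar>f x \<bullet> g x\<bar> \<le> (norm (f x))\<^sup>2 + (norm (g x))\<^sup>2" for x
  proof -
    have "2 * (norm (f x) * norm (g x)) \<le> (norm (f x))\<^sup>2 + (norm (g x))\<^sup>2"
      using sum_squares_bound[of "norm (f x)" "norm (g x)"] by (simp add: mult.assoc)
    moreover have "0 \<le> norm (f x) * norm (g x)" by simp
    ultimately show ?thesis
      using Cauchy_Schwarz_ineq2[of "f x" "g x"] by linarith
  qed
  then show "AE x in lebesgue_on \<Omega>. norm (f x \<bullet> g x) \<le> norm ((norm (f x))\<^sup>2 + (norm (g x))\<^sup>2)"
    by auto
qed

lemma L2_scaleR: "f \<in> L2 \<Omega> \<Longrightarrow> (\<lambda>x. c *\<^sub>R f x) \<in> L2 \<Omega>"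
  by (rule L2_bound[where f = f and B = "\<bar>c\<bar>"]) (auto intro: borel_measurable_scaleR L2_measurable)

lemma L2_add:
  assumes "f \<in> L2 \<Omega>" "g \<in> L2 \<Omega>"
  shows "(\<lambda>x. f x + g x) \<in> L2 \<Omega>"
proof -
  have "(norm (f x + g x))\<^sup>2 = (norm (f x))\<^sup>2 + (norm (g x))\<^sup>2 + 2 * (f x \<bullet> g x)" for x
    by (simp add: power2_norm_eq_inner inner_add_left inner_add_right inner_commute)
  then have "integrable (lebesgue_on \<Omega>) (\<lambda>x. (norm (f x + g x))\<^sup>2)"
    using L2_integrable[OF assms(1)] L2_integrable[OF assms(2)] L2_inner[OF assms] by simp
  then show ?thesis
    using L2_measurable[OF assms(1)] L2_measurable[OF assms(2)] by (simp add: L2_def)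
qed

lemma L2_diff: "f \<in> L2 \<Omega> \<Longrightarrow> g \<in> L2 \<Omega> \<Longrightarrow> (\<lambda>x. f x - g x) \<in> L2 \<Omega>"
  using L2_add[OF _ L2_scaleR[of g \<Omega> "-1"], of f] by simp

lemma sq_norm_scaleR: "sq_norm \<Omega> (\<lambda>x. c *\<^sub>R f x) = c\<^sup>2 * sq_norm \<Omega> f"
  by (simp add: sq_norm_def power_mult_distrib)

lemma sq_norm_add:
  assumes "f \<in> L2 \<Omega>" "g \<in> L2 \<Omega>"
  shows "sq_norm \<Omega> (\<lambda>x. f x + g x) = sq_norm \<Omega> f + sq_norm \<Omega> g + 2 * (\<integral>x. f x \<bullet> g x \<partial>lebesgue_on \<Omega>)"
proof -
  have "(norm (f x + g x))\<^sup>2 = (norm (f x))\<^sup>2 + (norm (g x))\<^sup>2 + 2 * (f x \<bullet> g x)" for x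
    by (simp add: power2_norm_eq_inner inner_add_left inner_add_right inner_commute)
  then show ?thesis
    using L2_integrable[OF assms(1)] L2_integrable[OF assms(2)] L2_inner[OF assms]
    by (simp add: sq_norm_def)
qed

lemma sq_norm_parallelogram:
  assumes "f \<in> L2 \<Omega>" "g \<in> L2 \<Omega>"
  shows "sq_norm \<Omega> (\<lambda>x. f x + g x) + sq_norm \<Omega> (\<lambda>x. f x - g x) = 2 * sq_norm \<Omega> f + 2 * sq_norm \<Omega> g"
  using sq_norm_add[OF assms] sq_norm_add[OF assms(1) L2_scaleR[OF assms(2), of "-1"]]
    sq_norm_scaleR[of \<Omega> "-1" g]
  by simp

lemma sq_norm_add_le:
  assumes "f \<in> L2 \<Omega>" "g \<in> L2 \<Omega>"
  shows "sq_norm \<Omega> (\<lambda>x. f x + g x) \<le> 2 * sq_norm \<Omega> f + 2 * sq_norm \<Omega> g"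
  using sq_norm_parallelogram[OF assms] sq_norm_nonneg[of \<Omega> "\<lambda>x. f x - g x"] by linarith

lemma L2_Cauchy_Schwarz:
  assumes f: "f \<in> L2 \<Omega>" and g: "g \<in> L2 \<Omega>"
  shows "\<bar>\<integral>x. f x \<bullet> g x \<partial>lebesgue_on \<Omega>\<bar> \<le> sqrt (sq_norm \<Omega> f) * sqrt (sq_norm \<Omega> g)"
proof -
  define I where "I = (\<integral>x. f x \<bullet> g x \<partial>lebesgue_on \<Omega>)"
  have pos: "0 \<le> a\<^sup>2 * sq_norm \<Omega> f + b\<^sup>2 * sq_norm \<Omega> g + 2 * (a * b * I)" for a b
    using sq_norm_add[OF L2_scaleR[OF f, of a] L2_scaleR[OF g, of b]]
      sq_norm_nonneg[of \<Omega> "\<lambda>x. a *\<^sub>R f x + b *\<^sub>R g x"]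
    by (simp add: sq_norm_scaleR I_def mult.left_commute)
  have "I\<^sup>2 \<le> sq_norm \<Omega> f * sq_norm \<Omega> g"
  proof (cases "sq_norm \<Omega> g = 0")
    case True
    have "I = 0"
    proof (rule ccontr)
      assume "I \<noteq> 0"
      then show False
        \<comment> \<open>With \<open>sq_norm \<Omega> g = 0\<close> the form is linear in its
          second coefficient; this choice makes its value \<open>- sq_norm \<Omega> f - 2\<close>,
          which is negative.\<close>
        using pos[of 1 "- (sq_norm \<Omega> f + 1) / I"] sq_norm_nonneg[of \<Omega> f] True by simp
    qed
    then show ?thesis using True by simp
  next
    case False
    then have "sq_norm \<Omega> g > 0"
      using sq_norm_nonneg[of \<Omega> g] by linarith
    moreover have "0 \<le> sq_norm \<Omega> g * (sq_norm \<Omega> f * sq_norm \<Omega> g - I\<^sup>2)"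
      \<comment> \<open>The minimizing ratio of the coefficients, scaled by
        \<open>sq_norm \<Omega> g\<close> to avoid a division.\<close>
      using pos[of "sq_norm \<Omega> g" "- I"] by (simp add: algebra_simps power2_eq_square)
    ultimately show ?thesis
      by (simp add: zero_le_mult_iff)
  qed
  then have "sqrt (I\<^sup>2) \<le> sqrt (sq_norm \<Omega> f * sq_norm \<Omega> g)"
    by (rule real_sqrt_le_mono)
  then show ?thesis
    by (simp add: I_def real_sqrt_mult)
qed

lemma L2_tendsto_inner:
  assumes f: "f \<in> L2 \<Omega>" and h: "\<And>n. h n \<in> L2 \<Omega>" and w: "w \<in> L2 \<Omega>"
    and lim: "(\<lambda>n. sq_norm \<Omega> (\<lambda>x. f x - h n x)) \<longlonglongrightarrow> 0"
  shows "(\<lambda>n. \<integral>x. h n x \<bullet> w x \<partial>lebesgue_on \<Omega>) \<longlonglongrightarrow> (\<integral>x. f x \<bullet> w x \<partial>lebesgue_on \<Omega>)"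
proof -
  have "(\<lambda>n. \<integral>x. (f x - h n x) \<bullet> w x \<partial>lebesgue_on \<Omega>) \<longlonglongrightarrow> 0"
  proof (rule Lim_null_comparison)
    show "\<forall>\<^sub>F n in sequentially. norm (\<integral>x. (f x - h n x) \<bullet> w x \<partial>lebesgue_on \<Omega>)
        \<le> sqrt (sq_norm \<Omega> (\<lambda>x. f x - h n x)) * sqrt (sq_norm \<Omega> w)"
      using L2_Cauchy_Schwarz[OF L2_diff[OF f h] w] by simp
    show "(\<lambda>n. sqrt (sq_norm \<Omega> (\<lambda>x. f x - h n x)) * sqrt (sq_norm \<Omega> w)) \<longlonglongrightarrow> 0"
      using tendsto_mult[OF tendsto_real_sqrt[OF lim] tendsto_const] by simp
  qed
  moreover have "(\<integral>x. (f x - h n x) \<bullet> w x \<partial>lebesgue_on \<Omega>) =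
      (\<integral>x. f x \<bullet> w x \<partial>lebesgue_on \<Omega>) - (\<integral>x. h n x \<bullet> w x \<partial>lebesgue_on \<Omega>)" for n
    using L2_inner[OF f w] L2_inner[OF h w] by (simp add: inner_diff_left)
  ultimately have "(\<lambda>n. (\<integral>x. f x \<bullet> w x \<partial>lebesgue_on \<Omega>) - (\<integral>x. h n x \<bullet> w x \<partial>lebesgue_on \<Omega>)) \<longlonglongrightarrow> 0"
    by simp
  from tendsto_diff[OF tendsto_const[of "\<integral>x. f x \<bullet> w x \<partial>lebesgue_on \<Omega>"] this]
  show ?thesis by simp
qed

lemma L2_tendsto_sq_norm:
  assumes f: "f \<in> L2 \<Omega>" and h: "\<And>n. h n \<in> L2 \<Omega>"
    and lim: "(\<lambda>n. sq_norm \<Omega> (\<lambda>x. f x - h n x)) \<longlonglongrightarrow> 0"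
  shows "(\<lambda>n. sq_norm \<Omega> (h n)) \<longlonglongrightarrow> sq_norm \<Omega> f"
proof -
  \<comment> \<open>Expanding the square of \<open>f - h n\<close> leaves a term that tends to 0 and
    an inner product with the fixed \<open>f\<close>, to which \<open>L2_tendsto_inner\<close>
    applies.\<close>
  have "sq_norm \<Omega> (h n) = sq_norm \<Omega> (\<lambda>x. f x - h n x) - sq_norm \<Omega> f
      + 2 * (\<integral>x. h n x \<bullet> f x \<partial>lebesgue_on \<Omega>)" for n
    using sq_norm_add[OF f L2_scaleR[OF h, of "-1" n]] sq_norm_scaleR[of \<Omega> "-1" "h n"]
    by (simp add: inner_commute)
  moreover have "(\<lambda>n. sq_norm \<Omega> (\<lambda>x. f x - h n x) - sq_norm \<Omega> f
      + 2 * (\<integral>x. h n x \<bullet> f x \<partial>lebesgue_on \<Omega>)) \<longlonglongrightarrow> 0 - sq_norm \<Omega> f + 2 * (\<integral>x. f x \<bullet> f x \<partial>lebesgue_on \<Omega>)"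
    by (intro tendsto_intros lim L2_tendsto_inner f h)
  moreover have "(\<integral>x. f x \<bullet> f x \<partial>lebesgue_on \<Omega>) = sq_norm \<Omega> f"
    by (simp add: sq_norm_def power2_norm_eq_inner)
  ultimately show ?thesis by simp
qed

lemma sq_norm_null_comparison:
  assumes "\<And>n. sq_norm \<Omega> (f n) \<le> B n" "B \<longlonglongrightarrow> 0"
  shows "(\<lambda>n. sq_norm \<Omega> (f n)) \<longlonglongrightarrow> 0"
  by (rule Lim_null_comparison[OF _ assms(2)]) (simp add: sq_norm_nonneg assms(1))

text \<open>The triangle inequality in squared form, at the price of a factor 2.\<close>

lemma sq_norm_tendsto_0_trans:
  assumes f: "f \<in> L2 \<Omega>" and h: "\<And>n. h n \<in> L2 \<Omega>" and h': "\<And>n. h' n \<in> L2 \<Omega>"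
    and lim: "(\<lambda>n. sq_norm \<Omega> (\<lambda>x. f x - h n x)) \<longlonglongrightarrow> 0"
    and lim': "(\<lambda>n. sq_norm \<Omega> (\<lambda>x. h n x - h' n x)) \<longlonglongrightarrow> 0"
  shows "(\<lambda>n. sq_norm \<Omega> (\<lambda>x. f x - h' n x)) \<longlonglongrightarrow> 0"
proof (rule sq_norm_null_comparison)
  show "sq_norm \<Omega> (\<lambda>x. f x - h' n x)
      \<le> 2 * sq_norm \<Omega> (\<lambda>x. f x - h n x) + 2 * sq_norm \<Omega> (\<lambda>x. h n x - h' n x)" for n
    using sq_norm_add_le[OF L2_diff[OF f h] L2_diff[OF h h'], of n n n] by simp
  show "(\<lambda>n. 2 * sq_norm \<Omega> (\<lambda>x. f x - h n x) + 2 * sq_norm \<Omega> (\<lambda>x. h n x - h' n x)) \<longlonglongrightarrow> 0"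
    using tendsto_add[OF tendsto_mult[OF tendsto_const lim] tendsto_mult[OF tendsto_const lim'], of 2 2]
    by simp
qed

text \<open>Dominated convergence with majorant \<open>B\<^sup>2 * (norm (g x))\<^sup>2\<close>. It
  serves wherever a derivative factor such as a smoothed sign converges only pointwise.\<close>

lemma sq_norm_scaleR_tendsto_0:
  assumes g: "g \<in> L2 \<Omega>" and s: "\<And>n. s n \<in> borel_measurable (lebesgue_on \<Omega>)"
    and bd: "\<And>n x. \<bar>s n x\<bar> \<le> B" and lim: "AE x in lebesgue_on \<Omega>. (\<lambda>n. s n x) \<longlonglongrightarrow> (0::real)"
  shows "(\<lambda>n. sq_norm \<Omega> (\<lambda>x. s n x *\<^sub>R g x)) \<longlonglongrightarrow> 0"
proof -
  note [measurable] = s L2_measurable[OF g]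
  have "(\<lambda>n. sq_norm \<Omega> (\<lambda>x. s n x *\<^sub>R g x)) \<longlonglongrightarrow> (\<integral>x. 0 \<partial>lebesgue_on \<Omega>)"
    unfolding sq_norm_def
  proof (rule integral_dominated_convergence)
    show "integrable (lebesgue_on \<Omega>) (\<lambda>x. B\<^sup>2 * (norm (g x))\<^sup>2)"
      using L2_integrable[OF g] by simp
    show "AE x in lebesgue_on \<Omega>. (\<lambda>n. (norm (s n x *\<^sub>R g x))\<^sup>2) \<longlonglongrightarrow> 0"
      using lim
    proof eventually_elim
      fix x assume "(\<lambda>n. s n x) \<longlonglongrightarrow> 0"
      then have "(\<lambda>n. (norm (s n x *\<^sub>R g x))\<^sup>2) \<longlonglongrightarrow> (norm (0 *\<^sub>R g x))\<^sup>2"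
        by (intro tendsto_intros)
      then show "(\<lambda>n. (norm (s n x *\<^sub>R g x))\<^sup>2) \<longlonglongrightarrow> 0" by simp
    qed
    show "AE x in lebesgue_on \<Omega>. norm ((norm (s n x *\<^sub>R g x))\<^sup>2) \<le> B\<^sup>2 * (norm (g x))\<^sup>2" for n
      using power_mono[OF bd abs_ge_zero, of _ _ 2]
      by (intro AE_I2) (simp add: power_mult_distrib mult_right_mono)
  qed auto
  then show ?thesis by simp
qed

lemma sq_norm_eq_0_AE:
  assumes "f \<in> L2 \<Omega>" "sq_norm \<Omega> f = 0"
  shows "AE x in lebesgue_on \<Omega>. f x = 0"
  using integral_nonneg_eq_0_iff_AE[OF L2_integrable[OF assms(1)]] assms(2)
  by (simp add: sq_norm_def)

text \<open>Lebesgue measure is complete. Through this, \<open>weak_grad\<close> inherits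
  measurability on \<Omega> from a square integrable gradient.\<close>

lemma borel_measurable_lebesgue_on_AE:
  fixes f g :: "'a::euclidean_space \<Rightarrow> 'b::euclidean_space"
  assumes \<Omega>: "\<Omega> \<in> sets lebesgue" and f: "f \<in> borel_measurable (lebesgue_on \<Omega>)"
    and eq: "AE x in lebesgue_on \<Omega>. f x = g x"
  shows "g \<in> borel_measurable (lebesgue_on \<Omega>)"
proof -
  have "(\<lambda>x. indicator \<Omega> x *\<^sub>R f x) \<in> borel_measurable lebesgue"
    using f \<Omega> by (simp add: borel_measurable_restrict_space_iff)
  moreover have "AE x in lebesgue. indicator \<Omega> x *\<^sub>R f x = indicator \<Omega> x *\<^sub>R g x"
    using eq \<Omega> by (auto simp: AE_restrict_space_iff indicator_def elim!: eventually_mono)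
  ultimately have "(\<lambda>x. indicator \<Omega> x *\<^sub>R g x) \<in> borel_measurable lebesgue"
    by (rule borel_measurable_AE)
  then show ?thesis
    using \<Omega> by (simp add: borel_measurable_restrict_space_iff)
qed

lemma sq_norm_cong_AE:
  assumes "\<Omega> \<in> sets lebesgue" "f \<in> borel_measurable (lebesgue_on \<Omega>)" "AE x in lebesgue_on \<Omega>. f x = g x"
  shows "sq_norm \<Omega> f = sq_norm \<Omega> g"
  unfolding sq_norm_def
proof (rule integral_cong_AE)
  show "AE x in lebesgue_on \<Omega>. (norm (f x))\<^sup>2 = (norm (g x))\<^sup>2"
    using assms(3) by eventually_elim simp
qed (use assms(2) borel_measurable_lebesgue_on_AE[OF assms] in measurable)

subsection \<open>The space \<open>H10\<close>\<close>

text \<open>Working with explicit pairs of a function and its gradient avoids the choice hidden in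
  \<open>weak_grad\<close>.\<close>

definition H10_pair :: "'a::euclidean_space set \<Rightarrow> ('a \<Rightarrow> real) \<Rightarrow> ('a \<Rightarrow> 'a) \<Rightarrow> bool" where
  "H10_pair \<Omega> u g \<longleftrightarrow> u \<in> L2 \<Omega> \<and> g \<in> L2 \<Omega> \<and> (\<exists>\<phi>. (\<forall>n::nat. \<phi> n \<in> test_functions \<Omega>) \<and>
     (\<lambda>n. sq_norm \<Omega> (\<lambda>x. u x - \<phi> n x)) \<longlonglongrightarrow> 0 \<and> (\<lambda>n. sq_norm \<Omega> (\<lambda>x. g x - grad (\<phi> n) x)) \<longlonglongrightarrow> 0)"

lemma H10_pairE:
  assumes "H10_pair \<Omega> u g"
  obtains \<phi> where "u \<in> L2 \<Omega>" "g \<in> L2 \<Omega>" "\<And>n::nat. \<phi> n \<in> test_functions \<Omega>"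
     "(\<lambda>n. sq_norm \<Omega> (\<lambda>x. u x - \<phi> n x)) \<longlonglongrightarrow> 0" "(\<lambda>n. sq_norm \<Omega> (\<lambda>x. g x - grad (\<phi> n) x)) \<longlonglongrightarrow> 0"
  using assms unfolding H10_pair_def by blast

lemma H10_pairI:
  assumes "u \<in> L2 \<Omega>" "g \<in> L2 \<Omega>" "\<And>n::nat. \<phi> n \<in> test_functions \<Omega>"
     "(\<lambda>n. sq_norm \<Omega> (\<lambda>x. u x - \<phi> n x)) \<longlonglongrightarrow> 0" "(\<lambda>n. sq_norm \<Omega> (\<lambda>x. g x - grad (\<phi> n) x)) \<longlonglongrightarrow> 0"
  shows "H10_pair \<Omega> u g"
  unfolding H10_pair_def using assms by (intro conjI exI[of _ \<phi>]) auto

lemma H10_pair_L2: "H10_pair \<Omega> u g \<Longrightarrow> u \<in> L2 \<Omega>" "H10_pair \<Omega> u g \<Longrightarrow> g \<in> L2 \<Omega>"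
  unfolding H10_pair_def by blast+

lemma test_functions_L2:
  fixes \<Omega> :: "'a::euclidean_space set"
  assumes "open \<Omega>" "\<phi> \<in> test_functions \<Omega>"
  shows "\<phi> \<in> L2 \<Omega>"
proof -
  have "(\<lambda>x. \<phi> x * \<phi> x) \<in> test_functions \<Omega>"
    using assms(2) test_functions_C_diff[OF assms(2)] by (rule test_functions_mult)
  from test_functions_lebesgue_on(2)[OF assms(1) this]
  have "integrable (lebesgue_on \<Omega>) (\<lambda>x. (norm (\<phi> x))\<^sup>2)"
    by (simp add: power2_eq_square)
  moreover have "\<phi> \<in> borel_measurable (lebesgue_on \<Omega>)"
    using test_functions_lebesgue_on(2)[OF assms] by simp
  ultimately show ?thesis by (simp add: L2_def)
qed

lemma L2_sum_Basis:
  assumes "\<And>b. b \<in> B \<Longrightarrow> f b \<in> L2 \<Omega>" "finite B" "\<Omega> \<in> sets lebesgue"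
  shows "(\<lambda>x. \<Sum>b\<in>B. f b x *\<^sub>R b) \<in> L2 \<Omega>"
  using assms(2,1)
proof (induction B rule: finite_induct)
  case empty
  then show ?case by (simp add: L2_def)
next
  case (insert b B)
  have "f b \<in> L2 \<Omega>" using insert by blast
  then have "(\<lambda>x. f b x *\<^sub>R b) \<in> L2 \<Omega>"
    by (rule L2_bound[where B = "norm b"])
      (use L2_measurable[OF \<open>f b \<in> L2 \<Omega>\<close>] in \<open>auto simp: mult.commute\<close>)
  then show ?case
    using insert by (auto intro!: L2_add)
qed

lemma grad_L2:
  assumes "open \<Omega>" "\<phi> \<in> test_functions \<Omega>"
  shows "grad \<phi> \<in> L2 \<Omega>"
proof -
  have "(\<lambda>x. \<Sum>b\<in>Basis. frechet_derivative \<phi> (at x) b *\<^sub>R b) \<in> L2 \<Omega>"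
    using assms by (intro L2_sum_Basis test_functions_L2 test_functions_frechet_derivative) auto
  then show ?thesis by (simp add: grad_def[abs_def])
qed

text \<open>A diagonal choice: for each \<open>n\<close> a test function within 1/(n+1) of both
  \<open>w n\<close> and its gradient \<open>h n\<close>.\<close>

lemma H10_pair_closed:
  assumes \<Omega>: "open \<Omega>" and u: "u \<in> L2 \<Omega>" and g: "g \<in> L2 \<Omega>"
    and p: "\<And>n::nat. H10_pair \<Omega> (w n) (h n)"
    and lim: "(\<lambda>n. sq_norm \<Omega> (\<lambda>x. u x - w n x)) \<longlonglongrightarrow> 0" "(\<lambda>n. sq_norm \<Omega> (\<lambda>x. g x - h n x)) \<longlonglongrightarrow> 0"
  shows "H10_pair \<Omega> u g"
proof -
  have "\<exists>\<phi>. \<phi> \<in> test_functions \<Omega> \<and> sq_norm \<Omega> (\<lambda>x. w n x - \<phi> x) < inverse (real (Suc n)) \<and>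
      sq_norm \<Omega> (\<lambda>x. h n x - grad \<phi> x) < inverse (real (Suc n))" for n
  proof -
    obtain \<phi> where \<phi>: "\<And>m. \<phi> m \<in> test_functions \<Omega>" "(\<lambda>m. sq_norm \<Omega> (\<lambda>x. w n x - \<phi> m x)) \<longlonglongrightarrow> 0"
      "(\<lambda>m. sq_norm \<Omega> (\<lambda>x. h n x - grad (\<phi> m) x)) \<longlonglongrightarrow> 0"
      by (rule H10_pairE[OF p[of n]]) blast
    have "\<forall>\<^sub>F m in sequentially. sq_norm \<Omega> (\<lambda>x. w n x - \<phi> m x) < inverse (real (Suc n)) \<and>
      sq_norm \<Omega> (\<lambda>x. h n x - grad (\<phi> m) x) < inverse (real (Suc n))"
      by (intro eventually_conj order_tendstoD(2)[OF \<phi>(2)] order_tendstoD(2)[OF \<phi>(3)]) auto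
    then show ?thesis
      using \<phi>(1) by (auto simp: eventually_sequentially)
  qed
  then obtain \<phi> where \<phi>: "\<And>n. \<phi> n \<in> test_functions \<Omega>"
    "\<And>n. sq_norm \<Omega> (\<lambda>x. w n x - \<phi> n x) < inverse (real (Suc n))"
    "\<And>n. sq_norm \<Omega> (\<lambda>x. h n x - grad (\<phi> n) x) < inverse (real (Suc n))"
    by metis
  have "(\<lambda>n. sq_norm \<Omega> (\<lambda>x. w n x - \<phi> n x)) \<longlonglongrightarrow> 0"
    by (rule sq_norm_null_comparison[OF less_imp_le[OF \<phi>(2)] LIMSEQ_inverse_real_of_nat])
  note wlim = sq_norm_tendsto_0_trans[OF u H10_pair_L2(1)[OF p] test_functions_L2[OF \<Omega> \<phi>(1)] lim(1) this]
  have "(\<lambda>n. sq_norm \<Omega> (\<lambda>x. h n x - grad (\<phi> n) x)) \<longlonglongrightarrow> 0"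
    by (rule sq_norm_null_comparison[OF less_imp_le[OF \<phi>(3)] LIMSEQ_inverse_real_of_nat])
  note sq_norm_tendsto_0_trans[OF g H10_pair_L2(2)[OF p] grad_L2[OF \<Omega> \<phi>(1)] lim(2) this]
  with u g \<phi>(1) wlim show ?thesis
    by (rule H10_pairI)
qed

lemma H10_pair_test_function:
  assumes "open \<Omega>" "\<phi> \<in> test_functions \<Omega>"
  shows "H10_pair \<Omega> \<phi> (grad \<phi>)"
  by (rule H10_pairI[OF test_functions_L2[OF assms] grad_L2[OF assms] assms(2)])
    (simp_all add: sq_norm_def)

lemma H10_pair_add_scale:
  assumes \<Omega>: "open \<Omega>" and 1: "H10_pair \<Omega> u g" and 2: "H10_pair \<Omega> u' g'"
  shows "H10_pair \<Omega> (\<lambda>x. u x + c * u' x) (\<lambda>x. g x + c *\<^sub>R g' x)"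
proof -
  obtain \<phi> where \<phi>: "u \<in> L2 \<Omega>" "g \<in> L2 \<Omega>" "\<And>n. \<phi> n \<in> test_functions \<Omega>"
    "(\<lambda>n. sq_norm \<Omega> (\<lambda>x. u x - \<phi> n x)) \<longlonglongrightarrow> 0" "(\<lambda>n. sq_norm \<Omega> (\<lambda>x. g x - grad (\<phi> n) x)) \<longlonglongrightarrow> 0"
    by (rule H10_pairE[OF 1]) (rule that)
  obtain \<psi> where \<psi>: "u' \<in> L2 \<Omega>" "g' \<in> L2 \<Omega>" "\<And>n. \<psi> n \<in> test_functions \<Omega>"
    "(\<lambda>n. sq_norm \<Omega> (\<lambda>x. u' x - \<psi> n x)) \<longlonglongrightarrow> 0" "(\<lambda>n. sq_norm \<Omega> (\<lambda>x. g' x - grad (\<psi> n) x)) \<longlonglongrightarrow> 0"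
    by (rule H10_pairE[OF 2]) (rule that)
  have L2: "(\<lambda>x. u x + c * u' x) \<in> L2 \<Omega>" "(\<lambda>x. g x + c *\<^sub>R g' x) \<in> L2 \<Omega>"
    using L2_add[OF \<phi>(1) L2_scaleR[OF \<psi>(1), of c]] L2_add[OF \<phi>(2) L2_scaleR[OF \<psi>(2), of c]] by auto
  have test: "(\<lambda>x. \<phi> n x + c * \<psi> n x) \<in> test_functions \<Omega>" for n
    by (intro test_functions_add test_functions_mult \<phi> \<psi> C_diff_const)
  have grad: "grad (\<lambda>x. \<phi> n x + c * \<psi> n x) = (\<lambda>x. grad (\<phi> n) x + c *\<^sub>R grad (\<psi> n) x)" for n
    by (rule ext) (rule grad_add_scale[OF \<phi>(3) \<psi>(3)])
  \<comment> \<open>Polymorphic in the codomain: it is used for the functions, where scaling is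
    multiplication of reals, and for the gradients.\<close>
  have lim: "(\<lambda>n. sq_norm \<Omega> (\<lambda>x. (f x + c *\<^sub>R f' x) - (h n x + c *\<^sub>R h' n x))) \<longlonglongrightarrow> 0"
    if "f \<in> L2 \<Omega>" "f' \<in> L2 \<Omega>" "\<And>n. h n \<in> L2 \<Omega>" "\<And>n. h' n \<in> L2 \<Omega>"
      "(\<lambda>n. sq_norm \<Omega> (\<lambda>x. f x - h n x)) \<longlonglongrightarrow> 0" "(\<lambda>n. sq_norm \<Omega> (\<lambda>x. f' x - h' n x)) \<longlonglongrightarrow> 0"
    for f f' :: "'a \<Rightarrow> 'c::euclidean_space" and h h'
  proof (rule sq_norm_null_comparison)
    have eq: "(f x + c *\<^sub>R f' x) - (h n x + c *\<^sub>R h' n x) = (f x - h n x) + c *\<^sub>R (f' x - h' n x)" for x n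
      by (simp add: algebra_simps)
    show "sq_norm \<Omega> (\<lambda>x. (f x + c *\<^sub>R f' x) - (h n x + c *\<^sub>R h' n x))
      \<le> 2 * sq_norm \<Omega> (\<lambda>x. f x - h n x) + 2 * (c\<^sup>2 * sq_norm \<Omega> (\<lambda>x. f' x - h' n x))" for n
      unfolding eq
      using sq_norm_add_le[OF L2_diff[OF that(1,3)] L2_scaleR[OF L2_diff[OF that(2,4)], of c], of n n]
      by (simp only: sq_norm_scaleR)
    show "(\<lambda>n. 2 * sq_norm \<Omega> (\<lambda>x. f x - h n x) + 2 * (c\<^sup>2 * sq_norm \<Omega> (\<lambda>x. f' x - h' n x))) \<longlonglongrightarrow> 0"
      using tendsto_add[OF tendsto_mult[OF tendsto_const that(5)]
          tendsto_mult[OF tendsto_const tendsto_mult[OF tendsto_const that(6)]], of 2 2 "c\<^sup>2"] by simp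
  qed
  show ?thesis
    using lim[OF \<phi>(1) \<psi>(1) test_functions_L2[OF \<Omega> \<phi>(3)] test_functions_L2[OF \<Omega> \<psi>(3)] \<phi>(4) \<psi>(4)]
      lim[OF \<phi>(2) \<psi>(2) grad_L2[OF \<Omega> \<phi>(3)] grad_L2[OF \<Omega> \<psi>(3)] \<phi>(5) \<psi>(5)]
    by (intro H10_pairI[OF L2 test]) (simp_all add: grad)
qed

section \<open>Estimates for the smoothed absolute value and sign\<close>

lemma smooth_abs_Lipschitz:
  fixes a b e :: real
  shows "\<bar>sqrt (a\<^sup>2 + e\<^sup>2) - sqrt (b\<^sup>2 + e\<^sup>2)\<bar> \<le> \<bar>a - b\<bar>"
proof -
  \<comment> \<open>The triangle inequality in the plane for (a, e) = (b, e) + (a - b, 0).\<close>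
  have "sqrt (a\<^sup>2 + e\<^sup>2) \<le> sqrt (b\<^sup>2 + e\<^sup>2) + \<bar>a - b\<bar>" for a b :: real
    using real_sqrt_sum_squares_triangle_ineq[of b "a - b" e 0] by simp
  from this[of a b] this[of b a] show ?thesis by linarith
qed

lemma smooth_abs_approx:
  fixes t e :: real
  assumes "e > 0"
  shows "\<bar>\<bar>t\<bar> - (sqrt (t\<^sup>2 + e\<^sup>2) - e)\<bar> \<le> e"
proof -
  have "\<bar>t\<bar> \<le> sqrt (t\<^sup>2 + e\<^sup>2)"
    by (rule real_le_rsqrt) simp
  moreover have "sqrt (t\<^sup>2 + e\<^sup>2) \<le> \<bar>t\<bar> + e"
    using real_sqrt_sum_squares_triangle_ineq[of t 0 0 e] assms by simp
  ultimately show ?thesis using assms by linarith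
qed

lemma smooth_sgn_le:
  fixes t e :: real
  shows "\<bar>t / sqrt (t\<^sup>2 + e\<^sup>2)\<bar> \<le> 1"
proof -
  have "\<bar>t\<bar> \<le> sqrt (t\<^sup>2 + e\<^sup>2)"
    by (rule real_le_rsqrt) simp
  then show ?thesis
    using divide_right_mono[of "\<bar>t\<bar>" "sqrt (t\<^sup>2 + e\<^sup>2)" "sqrt (t\<^sup>2 + e\<^sup>2)"]
    by (cases "t = 0 \<and> e = 0") auto
qed

text \<open>At \<open>t = 0\<close> every term is 0, which agrees with \<open>sgn 0 = 0\<close>; the
  limit gradient of the absolute value is thus 0 on the zero set.\<close>

lemma smooth_sgn_tendsto:
  fixes t :: real
  shows "(\<lambda>n. t / sqrt (t\<^sup>2 + (inverse (real (Suc n)))\<^sup>2)) \<longlonglongrightarrow> sgn t"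
proof (cases "t = 0")
  case False
  have "(\<lambda>n. t / sqrt (t\<^sup>2 + (inverse (real (Suc n)))\<^sup>2)) \<longlonglongrightarrow> t / sqrt (t\<^sup>2 + 0\<^sup>2)"
    using False by (intro tendsto_intros LIMSEQ_inverse_real_of_nat) auto
  moreover have "t / sqrt (t\<^sup>2 + 0\<^sup>2) = sgn t"
    using False by (simp add: sgn_if abs_if)
  ultimately show ?thesis by (simp only:)
qed simp

section \<open>Approximable pairs and \<open>H10\<close> on bounded open sets\<close>

locale bounded_open =
  fixes \<Omega> :: "'a::euclidean_space set"
  assumes open_\<Omega>: "open \<Omega>" and bounded_\<Omega>: "bounded \<Omega>"
begin

sublocale M: finite_measure "lebesgue_on \<Omega>"
  using open_\<Omega> bounded_\<Omega> by (intro finite_measure_lebesgue_on lmeasurable_open)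

lemma \<Omega>_sets: "\<Omega> \<in> sets lebesgue"
  using open_\<Omega> by auto

text \<open>Boundedness makes the measure finite, and t \<le> 1 + t^2.\<close>

lemma L2_imp_integrable:
  fixes u :: "'a \<Rightarrow> 'b::euclidean_space"
  assumes "u \<in> L2 \<Omega>"
  shows "integrable (lebesgue_on \<Omega>) u"
proof (rule Bochner_Integration.integrable_bound)
  show "integrable (lebesgue_on \<Omega>) (\<lambda>x. 1 + (norm (u x))\<^sup>2)"
    using L2_integrable[OF assms] by simp
  have "norm (u x) \<le> 1 + (norm (u x))\<^sup>2" for x
    using sum_squares_bound[of 1 "norm (u x)"] norm_ge_zero[of "u x"]
    unfolding power_one mult_1_right by linarith
  then show "AE x in lebesgue_on \<Omega>. norm (u x) \<le> norm (1 + (norm (u x))\<^sup>2)"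
    by (intro AE_I2) (metis abs_ge_self order_trans real_norm_def)
qed (use L2_measurable[OF assms] in auto)

lemma L2_locally_integrable:
  assumes "u \<in> L2 \<Omega>"
  shows "locally_integrable \<Omega> u"
  unfolding locally_integrable_def
proof safe
  fix K assume K: "compact K" "K \<subseteq> \<Omega>"
  have Ks: "K \<in> sets lebesgue" using K(1) by (simp add: borel_compact)
  have "integrable lebesgue (\<lambda>x. indicator \<Omega> x *\<^sub>R u x)"
    using L2_imp_integrable[OF assms] \<Omega>_sets by (simp add: integrable_restrict_space)
  from integrable_mult_indicator[OF Ks this]
  have "integrable lebesgue (\<lambda>x. indicator K x *\<^sub>R indicator \<Omega> x *\<^sub>R u x)" .
  moreover have "(\<lambda>x. indicator K x *\<^sub>R indicator \<Omega> x *\<^sub>R u x) = (\<lambda>x. indicator K x *\<^sub>R u x)"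
    using K by (auto simp: indicator_def fun_eq_iff)
  ultimately show "integrable (lebesgue_on K) u"
    using Ks by (simp add: integrable_restrict_space)
qed

text \<open>Integration by parts holds for the approximating test functions, and both of its sides
  converge by \<open>L2_tendsto_inner\<close>.\<close>

lemma H10_pair_has_weak_gradient:
  assumes "H10_pair \<Omega> u g"
  shows "has_weak_gradient \<Omega> u g"
  unfolding has_weak_gradient_def
proof (intro conjI ballI)
  obtain \<phi> where \<phi>: "u \<in> L2 \<Omega>" "g \<in> L2 \<Omega>" "\<And>n. \<phi> n \<in> test_functions \<Omega>"
    "(\<lambda>n. sq_norm \<Omega> (\<lambda>x. u x - \<phi> n x)) \<longlonglongrightarrow> 0" "(\<lambda>n. sq_norm \<Omega> (\<lambda>x. g x - grad (\<phi> n) x)) \<longlonglongrightarrow> 0"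
    by (rule H10_pairE[OF assms]) (rule that)
  show "locally_integrable \<Omega> u" "locally_integrable \<Omega> g"
    by (rule L2_locally_integrable[OF \<phi>(1)], rule L2_locally_integrable[OF \<phi>(2)])
  fix \<psi> and b :: 'a assume \<psi>: "\<psi> \<in> test_functions \<Omega>" and b: "b \<in> Basis"
  note D = test_functions_frechet_derivative[OF _ b]
  \<comment> \<open>As a vector field, \<psi> times \<open>b\<close> picks the coordinate
    \<open>b\<close> of a gradient by the inner product.\<close>
  have \<psi>b: "(\<lambda>x. \<psi> x *\<^sub>R b) \<in> L2 \<Omega>"
    by (rule L2_bound[where f = \<psi> and B = 1])
      (use b L2_measurable[OF test_functions_L2[OF open_\<Omega> \<psi>]] in
        \<open>auto intro: test_functions_L2[OF open_\<Omega> \<psi>]\<close>)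
  have lim1: "(\<lambda>n. \<integral>x. \<phi> n x \<bullet> frechet_derivative \<psi> (at x) b \<partial>lebesgue_on \<Omega>)
      \<longlonglongrightarrow> (\<integral>x. u x \<bullet> frechet_derivative \<psi> (at x) b \<partial>lebesgue_on \<Omega>)"
    by (intro L2_tendsto_inner \<phi> test_functions_L2 open_\<Omega> D \<psi>)
  have lim2: "(\<lambda>n. \<integral>x. grad (\<phi> n) x \<bullet> (\<psi> x *\<^sub>R b) \<partial>lebesgue_on \<Omega>)
      \<longlonglongrightarrow> (\<integral>x. g x \<bullet> (\<psi> x *\<^sub>R b) \<partial>lebesgue_on \<Omega>)"
    by (intro L2_tendsto_inner \<phi> grad_L2 open_\<Omega> \<psi>b)
  have "(\<integral>x. \<phi> n x \<bullet> frechet_derivative \<psi> (at x) b \<partial>lebesgue_on \<Omega>) =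
      - (\<integral>x. grad (\<phi> n) x \<bullet> (\<psi> x *\<^sub>R b) \<partial>lebesgue_on \<Omega>)" for n
  proof -
    have "(\<integral>x. \<phi> n x * frechet_derivative \<psi> (at x) b \<partial>lebesgue_on \<Omega>) =
      (\<integral>x. \<phi> n x * frechet_derivative \<psi> (at x) b \<partial>lborel)"
      by (intro test_functions_lebesgue_on open_\<Omega> test_functions_mult D \<psi> test_functions_C_diff[OF \<phi>(3)])
    moreover have "(\<integral>x. frechet_derivative (\<phi> n) (at x) b * \<psi> x \<partial>lebesgue_on \<Omega>) =
      (\<integral>x. frechet_derivative (\<phi> n) (at x) b * \<psi> x \<partial>lborel)"
      by (intro test_functions_lebesgue_on open_\<Omega> test_functions_mult \<psi> test_functions_C_diff[OF D[OF \<phi>(3)]])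
    ultimately show ?thesis
      using test_functions_parts[OF \<phi>(3) \<psi> b, of n] b by (simp add: grad_inner_Basis mult.commute)
  qed
  with LIMSEQ_unique[OF lim1] tendsto_minus[OF lim2]
  have "(\<integral>x. u x \<bullet> frechet_derivative \<psi> (at x) b \<partial>lebesgue_on \<Omega>) =
      - (\<integral>x. g x \<bullet> (\<psi> x *\<^sub>R b) \<partial>lebesgue_on \<Omega>)"
    by simp
  then show "(\<integral>x. u x * frechet_derivative \<psi> (at x) b \<partial>lebesgue_on \<Omega>) =
      - (\<integral>x. (g x \<bullet> b) * \<psi> x \<partial>lebesgue_on \<Omega>)"
    by (simp add: mult.commute)
qed

lemma weak_grad_AE:
  assumes "has_weak_gradient \<Omega> u g"
  shows "AE x in lebesgue_on \<Omega>. g x = weak_grad \<Omega> u x"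
proof -
  have "has_weak_gradient \<Omega> u (weak_grad \<Omega> u)"
    unfolding weak_grad_def using assms by (rule someI[where P = "has_weak_gradient \<Omega> u"])
  with assms show ?thesis
    by (rule has_weak_gradient_unique[OF open_\<Omega>])
qed

lemma H1_norm_power2:
  assumes "has_weak_gradient \<Omega> u g" "g \<in> L2 \<Omega>"
  shows "(H1_norm \<Omega> u)\<^sup>2 = sq_norm \<Omega> u + sq_norm \<Omega> g"
  using sq_norm_cong_AE[OF \<Omega>_sets L2_measurable[OF assms(2)] weak_grad_AE[OF assms(1)]]
  by (simp add: H1_norm_def L2_norm_power2 sq_norm_nonneg)

text \<open>For any admissible \<open>g\<close>, the squared \<open>H1_norm\<close> of
  \<open>u - \<phi> n\<close> splits into the two quantities that \<open>H10_pair\<close> sends to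
  0.\<close>

lemma H10_iff: "u \<in> H10 \<Omega> \<longleftrightarrow> (\<exists>g. H10_pair \<Omega> u g)"
proof
  assume "u \<in> H10 \<Omega>"
  then obtain g \<phi> where u: "u \<in> L2 \<Omega>" and g: "g \<in> L2 \<Omega>" "has_weak_gradient \<Omega> u g"
    and \<phi>: "\<And>n. \<phi> n \<in> test_functions \<Omega>" "(\<lambda>n. H1_norm \<Omega> (\<lambda>x. u x - \<phi> n x)) \<longlonglongrightarrow> 0"
    unfolding H10_def H1_def by blast
  have "(H1_norm \<Omega> (\<lambda>x. u x - \<phi> n x))\<^sup>2 =
      sq_norm \<Omega> (\<lambda>x. u x - \<phi> n x) + sq_norm \<Omega> (\<lambda>x. g x - grad (\<phi> n) x)" for n
    by (intro H1_norm_power2 has_weak_gradient_diff open_\<Omega> g L2_diff grad_L2 \<phi>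
        H10_pair_has_weak_gradient H10_pair_test_function)
  note eq = this
  have le: "sq_norm \<Omega> (\<lambda>x. u x - \<phi> n x) \<le> (H1_norm \<Omega> (\<lambda>x. u x - \<phi> n x))\<^sup>2"
    "sq_norm \<Omega> (\<lambda>x. g x - grad (\<phi> n) x) \<le> (H1_norm \<Omega> (\<lambda>x. u x - \<phi> n x))\<^sup>2" for n
    unfolding eq by (simp_all add: sq_norm_nonneg)
  have "(\<lambda>n. (H1_norm \<Omega> (\<lambda>x. u x - \<phi> n x))\<^sup>2) \<longlonglongrightarrow> 0"
    using tendsto_power[OF \<phi>(2), of 2] by simp
  then have "H10_pair \<Omega> u g"
    by (intro H10_pairI[OF u g(1) \<phi>(1)] sq_norm_null_comparison[OF le(1)]
        sq_norm_null_comparison[OF le(2)])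
  then show "\<exists>g. H10_pair \<Omega> u g" by (rule exI[where P = "H10_pair \<Omega> u"])
next
  assume "\<exists>g. H10_pair \<Omega> u g"
  then obtain g where p: "H10_pair \<Omega> u g" ..
  obtain \<phi> where \<phi>: "u \<in> L2 \<Omega>" "g \<in> L2 \<Omega>" "\<And>n. \<phi> n \<in> test_functions \<Omega>"
    "(\<lambda>n. sq_norm \<Omega> (\<lambda>x. u x - \<phi> n x)) \<longlonglongrightarrow> 0" "(\<lambda>n. sq_norm \<Omega> (\<lambda>x. g x - grad (\<phi> n) x)) \<longlonglongrightarrow> 0"
    by (rule H10_pairE[OF p]) (rule that)
  have "(H1_norm \<Omega> (\<lambda>x. u x - \<phi> n x))\<^sup>2 =
      sq_norm \<Omega> (\<lambda>x. u x - \<phi> n x) + sq_norm \<Omega> (\<lambda>x. g x - grad (\<phi> n) x)" for n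
    by (intro H1_norm_power2 has_weak_gradient_diff open_\<Omega> L2_diff grad_L2 \<phi>
        H10_pair_has_weak_gradient H10_pair_test_function p)
  then have "(\<lambda>n. (H1_norm \<Omega> (\<lambda>x. u x - \<phi> n x))\<^sup>2) \<longlonglongrightarrow> 0"
    using tendsto_add[OF \<phi>(4,5)] by simp
  then have "(\<lambda>n. H1_norm \<Omega> (\<lambda>x. u x - \<phi> n x)) \<longlonglongrightarrow> 0"
    by simp
  then show "u \<in> H10 \<Omega>"
    unfolding H10_def H1_def using \<phi>(1-3) H10_pair_has_weak_gradient[OF p] by blast
qed

text \<open>The chain rule for \<open>F\<close> with derivative \<open>T\<close>: composing the
  approximating test functions with \<open>F\<close> again gives test functions, and it remains to
  see that their gradients converge.\<close>

lemma H10_pair_smooth_abs: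
  assumes p: "H10_pair \<Omega> u g" and e: "e > 0"
  shows "H10_pair \<Omega> (\<lambda>x. sqrt ((u x)\<^sup>2 + e\<^sup>2) - e) (\<lambda>x. (u x / sqrt ((u x)\<^sup>2 + e\<^sup>2)) *\<^sub>R g x)"
proof -
  define F where "F = (\<lambda>t. sqrt (t\<^sup>2 + e\<^sup>2) - e)"
  define T where "T = (\<lambda>t. t / sqrt (t\<^sup>2 + e\<^sup>2))"
  obtain \<phi>0 where \<phi>0: "u \<in> L2 \<Omega>" "g \<in> L2 \<Omega>" "\<And>n. \<phi>0 n \<in> test_functions \<Omega>"
    "(\<lambda>n. sq_norm \<Omega> (\<lambda>x. u x - \<phi>0 n x)) \<longlonglongrightarrow> 0" "(\<lambda>n. sq_norm \<Omega> (\<lambda>x. g x - grad (\<phi>0 n) x)) \<longlonglongrightarrow> 0"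
    by (rule H10_pairE[OF p]) (rule that)
  \<comment> \<open>Mean-square convergence alone gives no pointwise limit of
    \<open>T (\<phi> n x)\<close>; a subsequence converges almost everywhere.\<close>
  have "\<exists>r::nat\<Rightarrow>nat. strict_mono r \<and> (AE x in lebesgue_on \<Omega>. (\<lambda>n. (u x - \<phi>0 (r n) x)\<^sup>2) \<longlonglongrightarrow> 0)"
  proof (rule tendsto_L1_AE_subseq)
    show "integrable (lebesgue_on \<Omega>) (\<lambda>x. (u x - \<phi>0 n x)\<^sup>2)" for n
      using L2_integrable[OF L2_diff[OF \<phi>0(1) test_functions_L2[OF open_\<Omega> \<phi>0(3)]]] by simp
    show "(\<lambda>n. \<integral>x. norm ((u x - \<phi>0 n x)\<^sup>2) \<partial>lebesgue_on \<Omega>) \<longlonglongrightarrow> 0"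
      using \<phi>0(4) by (simp add: sq_norm_def)
  qed
  then obtain r where r: "strict_mono r"
    and ae: "AE x in lebesgue_on \<Omega>. (\<lambda>n. (u x - \<phi>0 (r n) x)\<^sup>2) \<longlonglongrightarrow> 0" by blast
  define \<phi> where "\<phi> = (\<lambda>n. \<phi>0 (r n))"
  have \<phi>: "\<phi> n \<in> test_functions \<Omega>" for n
    by (simp add: \<phi>_def \<phi>0)
  have \<phi>u: "(\<lambda>n. sq_norm \<Omega> (\<lambda>x. u x - \<phi> n x)) \<longlonglongrightarrow> 0"
    using LIMSEQ_subseq_LIMSEQ[OF \<phi>0(4) r] by (simp add: \<phi>_def o_def)
  have \<phi>g: "(\<lambda>n. sq_norm \<Omega> (\<lambda>x. g x - grad (\<phi> n) x)) \<longlonglongrightarrow> 0"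
    using LIMSEQ_subseq_LIMSEQ[OF \<phi>0(5) r] by (simp add: \<phi>_def o_def)
  have T1: "\<bar>T t\<bar> \<le> 1" for t
    unfolding T_def by (rule smooth_sgn_le)
  have FL: "\<bar>F a - F b\<bar> \<le> \<bar>a - b\<bar>" for a b
    using smooth_abs_Lipschitz[of a e b] by (simp add: F_def)
  have F0: "F 0 = 0" using e by (simp add: F_def)
  have T_cont: "isCont T t" for t
    unfolding T_def using e by (intro continuous_intros) (auto simp: sum_power2_eq_zero_iff)
  have [measurable]: "T \<in> borel_measurable borel" "F \<in> borel_measurable borel"
    unfolding T_def F_def by measurable
  note mu = L2_measurable[OF \<phi>0(1)] L2_measurable[OF \<phi>0(2)]
    L2_measurable[OF test_functions_L2[OF open_\<Omega> \<phi>]] L2_measurable[OF grad_L2[OF open_\<Omega> \<phi>]]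
  note [measurable] = mu
  have Fu: "(\<lambda>x. F (u x)) \<in> L2 \<Omega>"
    by (rule L2_bound[OF \<phi>0(1), where B = 1]) (use FL[of _ 0] F0 in auto)
  have TL2: "(\<lambda>x. T (w x) *\<^sub>R h x) \<in> L2 \<Omega>"
    if "h \<in> L2 \<Omega>" "w \<in> borel_measurable (lebesgue_on \<Omega>)" for w and h :: "'a \<Rightarrow> 'a"
  proof (rule L2_bound[OF that(1), where B = 1])
    show "norm (T (w x) *\<^sub>R h x) \<le> 1 * norm (h x)" for x
      using T1[of "w x"] by (simp add: mult_left_le_one_le)
  qed (use that(2) L2_measurable[OF that(1)] in measurable)
  have "H10_pair \<Omega> (\<lambda>x. F (u x)) (\<lambda>x. T (u x) *\<^sub>R g x)"
  proof (rule H10_pairI[where \<phi> = "\<lambda>n x. F (\<phi> n x)"])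
    show F\<phi>: "(\<lambda>x. F (\<phi> n x)) \<in> test_functions \<Omega>" for n
      unfolding F_def by (rule test_functions_smooth_abs[OF \<phi> e])
    show "(\<lambda>n. sq_norm \<Omega> (\<lambda>x. F (u x) - F (\<phi> n x))) \<longlonglongrightarrow> 0"
    proof (rule sq_norm_null_comparison[OF _ \<phi>u])
      show "sq_norm \<Omega> (\<lambda>x. F (u x) - F (\<phi> n x)) \<le> sq_norm \<Omega> (\<lambda>x. u x - \<phi> n x)" for n
        by (intro sq_norm_mono L2_diff \<phi>0(1) Fu test_functions_L2 open_\<Omega> \<phi> F\<phi>) (simp add: FL)
    qed
    have gradF: "grad (\<lambda>x. F (\<phi> n x)) = (\<lambda>x. T (\<phi> n x) *\<^sub>R grad (\<phi> n) x)" for n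
      unfolding F_def T_def using test_functions_smooth_abs(2)[OF \<phi> e] by blast
    show "(\<lambda>n. sq_norm \<Omega> (\<lambda>x. T (u x) *\<^sub>R g x - grad (\<lambda>x. F (\<phi> n x)) x)) \<longlonglongrightarrow> 0"
      unfolding gradF
    \<comment> \<open>The error splits into (T u - T \<phi>) g, small by dominated convergence, and
      T \<phi> (g - grad \<phi>), small because \<open>T\<close> is bounded by 1.\<close>
    proof (rule sq_norm_tendsto_0_trans[where h = "\<lambda>n x. T (\<phi> n x) *\<^sub>R g x"])
      show "(\<lambda>n. sq_norm \<Omega> (\<lambda>x. T (u x) *\<^sub>R g x - T (\<phi> n x) *\<^sub>R g x)) \<longlonglongrightarrow> 0"
        unfolding scaleR_diff_left[symmetric]
      proof (rule sq_norm_scaleR_tendsto_0[where B = 2])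
        show "\<bar>T (u x) - T (\<phi> n x)\<bar> \<le> 2" for n x
          using T1[of "u x"] T1[of "\<phi> n x"] by linarith
        show "AE x in lebesgue_on \<Omega>. (\<lambda>n. T (u x) - T (\<phi> n x)) \<longlonglongrightarrow> 0"
          using ae
        proof eventually_elim
          fix x assume "(\<lambda>n. (u x - \<phi>0 (r n) x)\<^sup>2) \<longlonglongrightarrow> 0"
          then have "(\<lambda>n. u x - \<phi> n x) \<longlonglongrightarrow> 0"
            by (simp add: \<phi>_def)
          from tendsto_diff[OF tendsto_const[of "u x"] this]
          have "(\<lambda>n. \<phi> n x) \<longlonglongrightarrow> u x" by simp
          from tendsto_diff[OF tendsto_const isCont_tendsto_compose[OF T_cont this], of "T (u x)"]
          show "(\<lambda>n. T (u x) - T (\<phi> n x)) \<longlonglongrightarrow> 0" by simp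
        qed
      qed (use \<phi>0(2) in auto)
      show "(\<lambda>n. sq_norm \<Omega> (\<lambda>x. T (\<phi> n x) *\<^sub>R g x - T (\<phi> n x) *\<^sub>R grad (\<phi> n) x)) \<longlonglongrightarrow> 0"
        unfolding scaleR_diff_right[symmetric]
      proof (rule sq_norm_null_comparison[OF _ \<phi>g])
        show "sq_norm \<Omega> (\<lambda>x. T (\<phi> n x) *\<^sub>R (g x - grad (\<phi> n) x)) \<le> sq_norm \<Omega> (\<lambda>x. g x - grad (\<phi> n) x)" for n
          using T1 by (intro sq_norm_mono TL2 L2_diff \<phi>0(2) grad_L2 open_\<Omega> \<phi> mu(3))
            (simp add: mult_left_le_one_le)
      qed
    qed (use \<phi> in \<open>intro TL2 \<phi>0(2) mu grad_L2 open_\<Omega> \<phi>\<close>)+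
  qed (intro Fu TL2 \<phi>0 mu)+
  then show ?thesis
    by (simp add: F_def T_def)
qed

lemma H10_pair_abs:
  assumes p: "H10_pair \<Omega> u g"
  shows "H10_pair \<Omega> (\<lambda>x. \<bar>u x\<bar>) (\<lambda>x. sgn (u x) *\<^sub>R g x)"
proof -
  let ?e = "\<lambda>n. inverse (real (Suc n))"
  have e: "?e n > 0" "?e n \<le> 1" for n
    by (auto simp: inverse_le_1_iff)
  note [measurable] = L2_measurable[OF H10_pair_L2(1)[OF p]] L2_measurable[OF H10_pair_L2(2)[OF p]]
  have one: "(\<lambda>x. 1::real) \<in> L2 \<Omega>"
    by (simp add: L2_def)
  show ?thesis
  proof (rule H10_pair_closed[OF open_\<Omega> _ _ H10_pair_smooth_abs[OF p e(1)]])
    show "(\<lambda>x. \<bar>u x\<bar>) \<in> L2 \<Omega>"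
      by (rule L2_bound[OF H10_pair_L2(1)[OF p], where B = 1]) auto
    show "(\<lambda>x. sgn (u x) *\<^sub>R g x) \<in> L2 \<Omega>"
      by (rule L2_bound[OF H10_pair_L2(2)[OF p], where B = 1]) (auto simp: sgn_if)
    \<comment> \<open>Written as a multiplier of the constant 1, which is square integrable on a set
      of finite measure, so that dominated convergence applies.\<close>
    have "(\<lambda>n. sq_norm \<Omega> (\<lambda>x. (\<bar>u x\<bar> - (sqrt ((u x)\<^sup>2 + (?e n)\<^sup>2) - ?e n)) *\<^sub>R (1::real))) \<longlonglongrightarrow> 0"
    proof (rule sq_norm_scaleR_tendsto_0[OF one, where B = 1])
      show "\<bar>\<bar>u x\<bar> - (sqrt ((u x)\<^sup>2 + (?e n)\<^sup>2) - ?e n)\<bar> \<le> 1" for n x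
        using smooth_abs_approx[OF e(1)[of n], of "u x"] e(2)[of n] by linarith
      have "(\<lambda>n. \<bar>u x\<bar> - (sqrt ((u x)\<^sup>2 + (?e n)\<^sup>2) - ?e n)) \<longlonglongrightarrow> 0" for x
        by (rule Lim_null_comparison[OF _ LIMSEQ_inverse_real_of_nat])
          (use smooth_abs_approx[OF e(1)] in simp)
      then show "AE x in lebesgue_on \<Omega>. (\<lambda>n. \<bar>u x\<bar> - (sqrt ((u x)\<^sup>2 + (?e n)\<^sup>2) - ?e n)) \<longlonglongrightarrow> 0"
        by simp
    qed measurable
    then show "(\<lambda>n. sq_norm \<Omega> (\<lambda>x. \<bar>u x\<bar> - (sqrt ((u x)\<^sup>2 + (?e n)\<^sup>2) - ?e n))) \<longlonglongrightarrow> 0"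
      by simp
    show "(\<lambda>n. sq_norm \<Omega> (\<lambda>x. sgn (u x) *\<^sub>R g x - (u x / sqrt ((u x)\<^sup>2 + (?e n)\<^sup>2)) *\<^sub>R g x)) \<longlonglongrightarrow> 0"
      unfolding scaleR_diff_left[symmetric]
    proof (rule sq_norm_scaleR_tendsto_0[OF H10_pair_L2(2)[OF p], where B = 2])
      show "\<bar>sgn (u x) - u x / sqrt ((u x)\<^sup>2 + (?e n)\<^sup>2)\<bar> \<le> 2" for n x
        using smooth_sgn_le[of "u x" "?e n"] abs_sgn_eq[of "u x"]
        by (simp only: abs_le_iff split: if_splits) linarith+
      have "(\<lambda>n. sgn (u x) - u x / sqrt ((u x)\<^sup>2 + (?e n)\<^sup>2)) \<longlonglongrightarrow> 0" for x
        using tendsto_diff[OF tendsto_const smooth_sgn_tendsto, of "sgn (u x)" "u x"] by simp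
      then show "AE x in lebesgue_on \<Omega>. (\<lambda>n. sgn (u x) - u x / sqrt ((u x)\<^sup>2 + (?e n)\<^sup>2)) \<longlonglongrightarrow> 0"
        by simp
    qed measurable
  qed
qed

section \<open>The Poincare inequality with constant \<open>k_star\<close>\<close>

lemma test_function_Poincare:
  assumes k: "0 < k_star \<Omega>" and \<phi>: "\<phi> \<in> test_functions \<Omega>"
  shows "(k_star \<Omega>)\<^sup>2 * sq_norm \<Omega> \<phi> \<le> sq_norm \<Omega> (grad \<phi>)"
proof (cases "sq_norm \<Omega> \<phi> = 0")
  case False
  let ?S = "{\<phi> \<in> test_functions \<Omega>. \<exists>x. \<phi> x \<noteq> 0}"
  let ?R = "\<lambda>\<phi>. (L2_norm \<Omega> (grad \<phi>))\<^sup>2 / (L2_norm \<Omega> \<phi>)\<^sup>2"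
  have "\<phi> \<in> ?S"
  proof (rule ccontr)
    assume "\<phi> \<notin> ?S"
    then have "\<phi> = (\<lambda>x. 0)" using \<phi> by auto
    then show False using False by (simp add: sq_norm_def)
  qed
  moreover have "bdd_below (?R ` ?S)"
    by (rule bdd_belowI2[of _ 0]) auto
  ultimately have "(INF \<phi>\<in>?S. ?R \<phi>) \<le> ?R \<phi>"
    by (rule cINF_lower[rotated])
  \<comment> \<open>Positivity of the root makes the infimum positive, so squaring recovers
    it.\<close>
  moreover have "(k_star \<Omega>)\<^sup>2 = (INF \<phi>\<in>?S. ?R \<phi>)"
    using k unfolding k_star_def by simp
  ultimately have "(k_star \<Omega>)\<^sup>2 \<le> sq_norm \<Omega> (grad \<phi>) / sq_norm \<Omega> \<phi>"
    by (simp add: L2_norm_power2)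
  moreover have "sq_norm \<Omega> \<phi> > 0"
    using False sq_norm_nonneg[of \<Omega> \<phi>] by linarith
  ultimately show ?thesis
    by (simp add: field_simps)
qed (simp add: sq_norm_nonneg)

text \<open>Both sides are continuous along the approximating test functions.\<close>

lemma Poincare:
  assumes k: "0 < k_star \<Omega>" and p: "H10_pair \<Omega> u g"
  shows "(k_star \<Omega>)\<^sup>2 * sq_norm \<Omega> u \<le> sq_norm \<Omega> g"
proof -
  obtain \<phi> where \<phi>: "u \<in> L2 \<Omega>" "g \<in> L2 \<Omega>" "\<And>n. \<phi> n \<in> test_functions \<Omega>"
    "(\<lambda>n. sq_norm \<Omega> (\<lambda>x. u x - \<phi> n x)) \<longlonglongrightarrow> 0" "(\<lambda>n. sq_norm \<Omega> (\<lambda>x. g x - grad (\<phi> n) x)) \<longlonglongrightarrow> 0"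
    by (rule H10_pairE[OF p]) (rule that)
  have "(\<lambda>n. (k_star \<Omega>)\<^sup>2 * sq_norm \<Omega> (\<phi> n)) \<longlonglongrightarrow> (k_star \<Omega>)\<^sup>2 * sq_norm \<Omega> u"
    by (intro tendsto_intros L2_tendsto_sq_norm \<phi> test_functions_L2 open_\<Omega>)
  moreover have "(\<lambda>n. sq_norm \<Omega> (grad (\<phi> n))) \<longlonglongrightarrow> sq_norm \<Omega> g"
    by (intro L2_tendsto_sq_norm \<phi> grad_L2 open_\<Omega>)
  ultimately show ?thesis
    by (rule LIMSEQ_le) (use test_function_Poincare[OF k \<phi>(3)] in blast)
qed

end

subsection \<open>The energy\<close>

context bounded_open
begin

text \<open>The gradient is a separate argument, so the algebra of energies applies to arbitrary
  square integrable pairs without reference to \<open>weak_grad\<close>.\<close>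

definition energy :: "real \<Rightarrow> ('a \<Rightarrow> real) \<Rightarrow> ('a \<Rightarrow> real) \<Rightarrow> ('a \<Rightarrow> 'a) \<Rightarrow> real" where
  "energy k f u g = sq_norm \<Omega> g - k\<^sup>2 * sq_norm \<Omega> u - 2 * (\<integral>x. f x * u x \<partial>lebesgue_on \<Omega>)"

lemma L_infinity_imp_L2:
  assumes "f \<in> L_infinity \<Omega>"
  shows "f \<in> L2 \<Omega>"
proof -
  from assms obtain C where f: "f \<in> borel_measurable (lebesgue_on \<Omega>)"
    and C: "AE x in lebesgue_on \<Omega>. \<bar>f x\<bar> \<le> C"
    by (auto simp: L_infinity_def)
  have "integrable (lebesgue_on \<Omega>) (\<lambda>x. (norm (f x))\<^sup>2)"
  proof (rule M.integrable_const_bound[where B = "C\<^sup>2"])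
    show "AE x in lebesgue_on \<Omega>. norm ((norm (f x))\<^sup>2) \<le> C\<^sup>2"
      using C
    proof eventually_elim
      fix x assume "\<bar>f x\<bar> \<le> C"
      from power_mono[OF this abs_ge_zero, of 2] show "norm ((norm (f x))\<^sup>2) \<le> C\<^sup>2"
        by simp
    qed
  qed (use f in measurable)
  then show ?thesis using f by (simp add: L2_def)
qed

lemma J_scalar_eq_energy:
  assumes p: "H10_pair \<Omega> u g" and f: "f \<in> L2 \<Omega>"
  shows "J_scalar \<Omega> k f u = energy k f u g"
proof -
  note u = H10_pair_L2(1)[OF p] and g = H10_pair_L2(2)[OF p]
  note ae = weak_grad_AE[OF H10_pair_has_weak_gradient[OF p]]
  note [measurable] = L2_measurable[OF u] L2_measurable[OF g] L2_measurable[OF f]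
    borel_measurable_lebesgue_on_AE[OF \<Omega>_sets L2_measurable[OF g] ae]
  have "J_scalar \<Omega> k f u = (\<integral>x. (norm (g x))\<^sup>2 - k\<^sup>2 * \<bar>u x\<bar>\<^sup>2 - 2 * f x * u x \<partial>lebesgue_on \<Omega>)"
    unfolding J_scalar_def
  proof (rule integral_cong_AE)
    show "AE x in lebesgue_on \<Omega>. (norm (weak_grad \<Omega> u x))\<^sup>2 - k\<^sup>2 * \<bar>u x\<bar>\<^sup>2 - 2 * f x * u x =
        (norm (g x))\<^sup>2 - k\<^sup>2 * \<bar>u x\<bar>\<^sup>2 - 2 * f x * u x"
      using ae by eventually_elim simp
  qed measurable
  also have "\<dots> = energy k f u g"
    using L2_integrable[OF u] L2_integrable[OF g] L2_inner[OF f u]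
    by (simp add: energy_def sq_norm_def mult.assoc)
  finally show ?thesis .
qed

text \<open>The quadratic parts obey the parallelogram law, and the term linear in \<open>d\<close>
  cancels between the two signs.\<close>

lemma energy_parallelogram:
  assumes L2: "s \<in> L2 \<Omega>" "d \<in> L2 \<Omega>" "g \<in> L2 \<Omega>" "h \<in> L2 \<Omega>" "f \<in> L2 \<Omega>"
  shows "energy k f (\<lambda>x. s x + d x) (\<lambda>x. g x + h x) + energy k f (\<lambda>x. s x - d x) (\<lambda>x. g x - h x) =
    2 * energy k f s g + 2 * (sq_norm \<Omega> h - k\<^sup>2 * sq_norm \<Omega> d)"
proof -
  have "(\<integral>x. f x * (s x + d x) \<partial>lebesgue_on \<Omega>) + (\<integral>x. f x * (s x - d x) \<partial>lebesgue_on \<Omega>) =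
      2 * (\<integral>x. f x * s x \<partial>lebesgue_on \<Omega>)"
    using L2_inner[OF L2(5,1)] L2_inner[OF L2(5,2)] by (simp add: distrib_left right_diff_distrib)
  moreover have "k\<^sup>2 * sq_norm \<Omega> (\<lambda>x. s x + d x) + k\<^sup>2 * sq_norm \<Omega> (\<lambda>x. s x - d x) =
      2 * (k\<^sup>2 * sq_norm \<Omega> s) + 2 * (k\<^sup>2 * sq_norm \<Omega> d)"
    using arg_cong[OF sq_norm_parallelogram[OF L2(1,2)], of "\<lambda>z. k\<^sup>2 * z"] by (simp add: distrib_left)
  ultimately show ?thesis
    using sq_norm_parallelogram[OF L2(3,4)] by (simp add: energy_def)
qed

lemma H10_pair_half_sum:
  assumes "H10_pair \<Omega> a g" "H10_pair \<Omega> b h"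
  shows "H10_pair \<Omega> (\<lambda>x. (a x + b x) / 2) (\<lambda>x. (1/2) *\<^sub>R (g x + h x))"
    and "H10_pair \<Omega> (\<lambda>x. (a x - b x) / 2) (\<lambda>x. (1/2) *\<^sub>R (g x - h x))"
proof -
  \<comment> \<open>The zero pair as first summand turns \<open>H10_pair_add_scale\<close> into
    scaling by one half.\<close>
  note z = H10_pair_test_function[OF open_\<Omega> test_functions_zero]
  have z0: "grad (\<lambda>x. 0) = (\<lambda>x. 0)"
    by (rule ext, rule grad_eqI) simp
  show "H10_pair \<Omega> (\<lambda>x. (a x + b x) / 2) (\<lambda>x. (1/2) *\<^sub>R (g x + h x))"
    using H10_pair_add_scale[OF open_\<Omega> z H10_pair_add_scale[OF open_\<Omega> assms, of 1], of "1/2"]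
    by (simp add: z0)
  show "H10_pair \<Omega> (\<lambda>x. (a x - b x) / 2) (\<lambda>x. (1/2) *\<^sub>R (g x - h x))"
    using H10_pair_add_scale[OF open_\<Omega> z H10_pair_add_scale[OF open_\<Omega> assms, of "-1"], of "1/2"]
    by (simp add: z0)
qed

lemma J_scalar_max_min:
  assumes a: "a \<in> H10 \<Omega>" and b: "b \<in> H10 \<Omega>" and f: "f \<in> L2 \<Omega>"
  shows "(\<lambda>x. max (a x) (b x)) \<in> H10 \<Omega>" "(\<lambda>x. min (a x) (b x)) \<in> H10 \<Omega>"
    and "J_scalar \<Omega> k f (\<lambda>x. max (a x) (b x)) + J_scalar \<Omega> k f (\<lambda>x. min (a x) (b x))
      \<le> J_scalar \<Omega> k f a + J_scalar \<Omega> k f b"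
proof -
  obtain ga gb where pa: "H10_pair \<Omega> a ga" and pb: "H10_pair \<Omega> b gb"
    using a b by (auto simp: H10_iff)
  define s where "s = (\<lambda>x. (a x + b x) / 2)"
  define d where "d = (\<lambda>x. (a x - b x) / 2)"
  define gs where "gs = (\<lambda>x. (1/2) *\<^sub>R (ga x + gb x))"
  define gd where "gd = (\<lambda>x. (1/2) *\<^sub>R (ga x - gb x))"
  define h where "h = (\<lambda>x. sgn (d x) *\<^sub>R gd x)"
  have ps: "H10_pair \<Omega> s gs" and pd: "H10_pair \<Omega> d gd"
    using H10_pair_half_sum[OF pa pb] by (simp_all add: s_def d_def gs_def gd_def)
  have ph: "H10_pair \<Omega> (\<lambda>x. \<bar>d x\<bar>) h"
    using H10_pair_abs[OF pd] by (simp add: h_def)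
  \<comment> \<open>Half-sum \<open>s\<close> and half-difference \<open>d\<close> give both pairs
    the form \<open>s\<close> plus or minus something: \<open>d\<close> for \<open>a\<close> and
    \<open>b\<close>, its absolute value for max and min. The two energy sums then differ only in
    \<open>h\<close> against \<open>gd\<close>.\<close>
  have max: "(\<lambda>x. max (a x) (b x)) = (\<lambda>x. s x + \<bar>d x\<bar>)"
    and min: "(\<lambda>x. min (a x) (b x)) = (\<lambda>x. s x - \<bar>d x\<bar>)"
    by (auto simp: s_def d_def max_def min_def fun_eq_iff field_simps)
  have ab: "a = (\<lambda>x. s x + d x)" "b = (\<lambda>x. s x - d x)"
    by (auto simp: s_def d_def fun_eq_iff field_simps)
  have gab: "ga = (\<lambda>x. gs x + gd x)" "gb = (\<lambda>x. gs x - gd x)"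
    by (auto simp: gs_def gd_def fun_eq_iff scaleR_add_right[symmetric] scaleR_diff_right[symmetric])
  have pmax: "H10_pair \<Omega> (\<lambda>x. max (a x) (b x)) (\<lambda>x. gs x + h x)"
    using H10_pair_add_scale[OF open_\<Omega> ps ph, of 1] by (simp add: max)
  have pmin: "H10_pair \<Omega> (\<lambda>x. min (a x) (b x)) (\<lambda>x. gs x - h x)"
    using H10_pair_add_scale[OF open_\<Omega> ps ph, of "-1"] by (simp add: min)
  show "(\<lambda>x. max (a x) (b x)) \<in> H10 \<Omega>" "(\<lambda>x. min (a x) (b x)) \<in> H10 \<Omega>"
    using pmax pmin H10_iff by blast+
  note L2 = H10_pair_L2[OF ps] H10_pair_L2[OF pd] H10_pair_L2[OF ph]
  have "sq_norm \<Omega> h \<le> sq_norm \<Omega> gd"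
    using L2 by (intro sq_norm_mono) (auto simp: h_def sgn_if)
  moreover have "sq_norm \<Omega> (\<lambda>x. \<bar>d x\<bar>) = sq_norm \<Omega> d"
    by (simp add: sq_norm_def)
  moreover have "energy k f (\<lambda>x. max (a x) (b x)) (\<lambda>x. gs x + h x) +
      energy k f (\<lambda>x. min (a x) (b x)) (\<lambda>x. gs x - h x) =
      2 * energy k f s gs + 2 * (sq_norm \<Omega> h - k\<^sup>2 * sq_norm \<Omega> (\<lambda>x. \<bar>d x\<bar>))"
    unfolding max min using L2 f by (intro energy_parallelogram)
  moreover have "energy k f a ga + energy k f b gb =
      2 * energy k f s gs + 2 * (sq_norm \<Omega> gd - k\<^sup>2 * sq_norm \<Omega> d)"
    unfolding ab gab using L2 f by (intro energy_parallelogram)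
  ultimately show "J_scalar \<Omega> k f (\<lambda>x. max (a x) (b x)) + J_scalar \<Omega> k f (\<lambda>x. min (a x) (b x))
      \<le> J_scalar \<Omega> k f a + J_scalar \<Omega> k f b"
    by (simp add: J_scalar_eq_energy[OF pmax f] J_scalar_eq_energy[OF pmin f]
        J_scalar_eq_energy[OF pa f] J_scalar_eq_energy[OF pb f])
qed

text \<open>The midpoint defect is twice
  \<open>sq_norm \<Omega> gd - k\<^sup>2 * sq_norm \<Omega> d\<close>, and by
  \<open>Poincare\<close> at least twice \<open>(k_star \<Omega>)\<^sup>2 - k\<^sup>2\<close> times
  \<open>sq_norm \<Omega> d\<close>. A defect that is not positive forces the half-difference
  \<open>d\<close> to vanish.\<close>

lemma J_scalar_strictly_convex:
  assumes k: "0 \<le> k" "k < k_star \<Omega>" and a: "a \<in> H10 \<Omega>" and b: "b \<in> H10 \<Omega>" and f: "f \<in> L2 \<Omega>"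
  shows "(\<lambda>x. (a x + b x) / 2) \<in> H10 \<Omega>"
    and "J_scalar \<Omega> k f a + J_scalar \<Omega> k f b \<le> 2 * J_scalar \<Omega> k f (\<lambda>x. (a x + b x) / 2) \<Longrightarrow>
      AE x in lebesgue_on \<Omega>. a x = b x"
proof -
  obtain ga gb where pa: "H10_pair \<Omega> a ga" and pb: "H10_pair \<Omega> b gb"
    using a b by (auto simp: H10_iff)
  define s where "s = (\<lambda>x. (a x + b x) / 2)"
  define d where "d = (\<lambda>x. (a x - b x) / 2)"
  define gs where "gs = (\<lambda>x. (1/2) *\<^sub>R (ga x + gb x))"
  define gd where "gd = (\<lambda>x. (1/2) *\<^sub>R (ga x - gb x))"
  have ps: "H10_pair \<Omega> s gs" and pd: "H10_pair \<Omega> d gd"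
    using H10_pair_half_sum[OF pa pb] by (simp_all add: s_def d_def gs_def gd_def)
  then show "(\<lambda>x. (a x + b x) / 2) \<in> H10 \<Omega>"
    using H10_iff s_def by blast
  have ab: "a = (\<lambda>x. s x + d x)" "b = (\<lambda>x. s x - d x)"
    by (auto simp: s_def d_def fun_eq_iff field_simps)
  have gab: "ga = (\<lambda>x. gs x + gd x)" "gb = (\<lambda>x. gs x - gd x)"
    by (auto simp: gs_def gd_def fun_eq_iff scaleR_add_right[symmetric] scaleR_diff_right[symmetric])
  note L2 = H10_pair_L2[OF ps] H10_pair_L2[OF pd]
  have "energy k f a ga + energy k f b gb =
      2 * energy k f s gs + 2 * (sq_norm \<Omega> gd - k\<^sup>2 * sq_norm \<Omega> d)"
    unfolding ab gab using L2 f by (intro energy_parallelogram)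
  then have J: "J_scalar \<Omega> k f a + J_scalar \<Omega> k f b =
      2 * J_scalar \<Omega> k f s + 2 * (sq_norm \<Omega> gd - k\<^sup>2 * sq_norm \<Omega> d)"
    by (simp add: J_scalar_eq_energy[OF ps f] J_scalar_eq_energy[OF pa f] J_scalar_eq_energy[OF pb f])
  assume "J_scalar \<Omega> k f a + J_scalar \<Omega> k f b \<le> 2 * J_scalar \<Omega> k f (\<lambda>x. (a x + b x) / 2)"
  with J have "sq_norm \<Omega> gd \<le> k\<^sup>2 * sq_norm \<Omega> d"
    by (simp add: s_def)
  moreover have "(k_star \<Omega>)\<^sup>2 * sq_norm \<Omega> d \<le> sq_norm \<Omega> gd"
    using k pd by (intro Poincare) auto
  ultimately have "((k_star \<Omega>)\<^sup>2 - k\<^sup>2) * sq_norm \<Omega> d \<le> 0"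
    by (simp add: left_diff_distrib)
  moreover have "(k_star \<Omega>)\<^sup>2 - k\<^sup>2 > 0"
    using power_strict_mono[OF k(2,1), of 2] by simp
  ultimately have "sq_norm \<Omega> d = 0"
    using sq_norm_nonneg[of \<Omega> d] by (simp add: mult_le_0_iff)
  with L2(3) have "AE x in lebesgue_on \<Omega>. d x = 0"
    by (rule sq_norm_eq_0_AE)
  then show "AE x in lebesgue_on \<Omega>. a x = b x"
    by eventually_elim (simp add: d_def)
qed

end

section \<open>From tuples to components, and from order to supports\<close>

lemma J_functional_fun_upd:
  assumes "i \<in> {1..m}"
  shows "J_functional \<Omega> m ks f (w(i := z)) =
    J_functional \<Omega> m ks f w - J_scalar \<Omega> (ks i) (f i) (w i) + J_scalar \<Omega> (ks i) (f i) z"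
proof -
  \<comment> \<open>The functional is a sum over the components, so changing one of them affects a
    single summand.\<close>
  have "J_functional \<Omega> m ks f w' = J_scalar \<Omega> (ks i) (f i) (w' i) +
      (\<Sum>j\<in>{1..m} - {i}. J_scalar \<Omega> (ks j) (f j) (w' j))" for w'
    unfolding J_functional_def using assms by (intro sum.remove) auto
  moreover have "(\<Sum>j\<in>{1..m} - {i}. J_scalar \<Omega> (ks j) (f j) ((w(i := z)) j)) =
      (\<Sum>j\<in>{1..m} - {i}. J_scalar \<Omega> (ks j) (f j) (w j))"
    by (intro sum.cong) auto
  ultimately show ?thesis by simp
qed

text \<open>On an open set where \<open>v\<close> vanishes almost everywhere, \<open>u\<close> is
  squeezed to 0, so every set removed for \<open>v\<close> is also removed for
  \<open>u\<close>.\<close>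

lemma ess_supp_mono:
  assumes \<Omega>: "open \<Omega>" and "AE x in lebesgue_on \<Omega>. 0 \<le> u x \<and> u x \<le> v x"
  shows "ess_supp \<Omega> u \<subseteq> ess_supp \<Omega> v"
proof -
  have "AE x in lebesgue_on U. u x = 0"
    if U: "open U" "U \<subseteq> \<Omega>" and v: "AE x in lebesgue_on U. v x = 0" for U
  proof -
    have "AE x in lebesgue. x \<in> \<Omega> \<longrightarrow> 0 \<le> u x \<and> u x \<le> v x"
      using assms by (simp add: AE_restrict_space_iff del: AE_conj_iff)
    moreover have "AE x in lebesgue. x \<in> U \<longrightarrow> v x = 0"
      using v U by (simp add: AE_restrict_space_iff)
    ultimately have "AE x in lebesgue. x \<in> U \<longrightarrow> u x = 0"
      by eventually_elim (use U in auto)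
    then show ?thesis
      using U by (simp add: AE_restrict_space_iff)
  qed
  then show ?thesis
    unfolding ess_supp_def by blast
qed

theorem theorem2p3:
  fixes \<Omega> :: "(real ^ 'n) set"
    and m :: nat and ks :: "nat \<Rightarrow> real" and k :: real
    and f u v :: "nat \<Rightarrow> real ^ 'n \<Rightarrow> real"
  assumes "CARD('n) \<ge> 2"
    and "bounded_lipschitz_domain \<Omega>"
    and "\<And>i. i \<in> {1..m} \<Longrightarrow> ks i = k"
    and "0 \<le> k" and "k < k_star \<Omega>"
    and "\<And>i. i \<in> {1..m} \<Longrightarrow> f i \<in> L_infinity \<Omega>"
    and "is_arg_min (J_functional \<Omega> m ks f) (\<lambda>w. w \<in> S_set \<Omega> m) u"
    and "is_arg_min (J_functional \<Omega> m ks f) (\<lambda>w. w \<in> K_set \<Omega> m) v"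
  shows "\<forall>i\<in>{1..m}. ess_supp \<Omega> (u i) \<subseteq> ess_supp \<Omega> (v i)"
proof
  fix i assume i: "i \<in> {1..m}"
  interpret bounded_open \<Omega>
    using assms(2) by unfold_locales (auto simp: bounded_lipschitz_domain_def)
  let ?J = "J_scalar \<Omega> k (f i)"
  let ?max = "\<lambda>x. max (u i x) (v i x)" and ?min = "\<lambda>x. min (u i x) (v i x)"
  have fi: "f i \<in> L2 \<Omega>"
    using assms(6)[OF i] by (rule L_infinity_imp_L2)
  have uS: "u \<in> S_set \<Omega> m" and umin: "\<And>w. w \<in> S_set \<Omega> m \<Longrightarrow> J_functional \<Omega> m ks f u \<le> J_functional \<Omega> m ks f w"
    using assms(7) by (auto simp: is_arg_min_linorder)
  have vK: "v \<in> K_set \<Omega> m" and vmin: "\<And>w. w \<in> K_set \<Omega> m \<Longrightarrow> J_functional \<Omega> m ks f v \<le> J_functional \<Omega> m ks f w"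
    using assms(8) by (auto simp: is_arg_min_linorder)
  have u_H10: "u i \<in> H10 \<Omega>" and u_nonneg: "AE x in lebesgue_on \<Omega>. 0 \<le> u i x"
    using uS i by (auto simp: S_set_def K_set_def)
  have v_H10: "v i \<in> H10 \<Omega>" and v_nonneg: "AE x in lebesgue_on \<Omega>. 0 \<le> v i x"
    using vK i by (auto simp: K_set_def)
  note lattice = J_scalar_max_min[OF u_H10 v_H10 fi]
  \<comment> \<open>\<open>K_set\<close> constrains each component separately, so \<open>v i\<close>
    minimizes the scalar functional by itself.\<close>
  have v_le: "?J (v i) \<le> ?J z" if "z \<in> H10 \<Omega>" "AE x in lebesgue_on \<Omega>. 0 \<le> z x" for z
  proof -
    have "v(i := z) \<in> K_set \<Omega> m"
      using vK that by (auto simp: K_set_def)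
    from vmin[OF this] show ?thesis
      using assms(3)[OF i] by (simp add: J_functional_fun_upd[OF i])
  qed
  have u_le: "?J (u i) \<le> ?J ?min"
  proof -
    have "u(i := ?min) \<in> K_set \<Omega> m"
      using uS lattice(2) u_nonneg v_nonneg by (auto simp: K_set_def S_set_def)
    \<comment> \<open>As \<open>v i\<close> is nonnegative, the minimum is 0 wherever
      \<open>u i\<close> is 0. Both orders of the product appear because \<open>S_set\<close> ranges
      over ordered pairs of indices.\<close>
    moreover have "AE x in lebesgue_on \<Omega>. ?min x * u j x = 0 \<and> u j x * ?min x = 0" if "j \<in> {1..m}" "j \<noteq> i" for j
    proof -
      have "AE x in lebesgue_on \<Omega>. u i x * u j x = 0"
        using uS i that by (auto simp: S_set_def)
      with v_nonneg show ?thesis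
        by eventually_elim (auto simp: min_def)
    qed
    ultimately have "u(i := ?min) \<in> S_set \<Omega> m"
      using uS by (auto simp: S_set_def)
    from umin[OF this] show ?thesis
      using assms(3)[OF i] by (simp add: J_functional_fun_upd[OF i])
  qed
  have max_nonneg: "AE x in lebesgue_on \<Omega>. 0 \<le> ?max x"
    using v_nonneg by eventually_elim auto
  have "?J ?max \<le> ?J (v i)"
    using lattice(3)[of k] u_le by linarith
  \<comment> \<open>The midpoint is an admissible competitor for \<open>v i\<close>, so the energies
    of \<open>?max\<close> and \<open>v i\<close> add up to at most twice that of the midpoint: the
    equality case of strict convexity.\<close>
  moreover have "AE x in lebesgue_on \<Omega>. 0 \<le> (?max x + v i x) / 2"
    using max_nonneg v_nonneg by eventually_elim auto
  note v_le[OF J_scalar_strictly_convex(1)[OF assms(4,5) lattice(1) v_H10 fi] this]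
  ultimately have "AE x in lebesgue_on \<Omega>. ?max x = v i x"
    by (intro J_scalar_strictly_convex(2)[OF assms(4,5) lattice(1) v_H10 fi]) linarith
  with u_nonneg have "AE x in lebesgue_on \<Omega>. 0 \<le> u i x \<and> u i x \<le> v i x"
    by eventually_elim (auto simp: max_def split: if_splits)
  then show "ess_supp \<Omega> (u i) \<subseteq> ess_supp \<Omega> (v i)"
    by (rule ess_supp_mono[OF open_\<Omega>])
qed

end
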